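(* Let $d\ge 2$ and $s>d/2$, and let $(X_N)$ be a sequence of QMC designs for $\mathbb{H}^s(\mathbb{S}^d)$. Then $(X_N)$ is a sequence of QMC designs for $\mathbb{H}^{s'}(\mathbb{S}^d)$ for all $s'$ satisfying $d/2<s'\le s$.
   Context: $\mathbb{S}^d$ is the unit sphere in $\mathbb{R}^{d+1}$, $d\ge 2$, and $\sigma_d$ is its normalized surface measure ($\sigma_d(\mathbb{S}^d)=1$). Let $\{Y_{\ell,k}:k=1,\dots,Z(d,\ell)\}$ be an $\mathbb{L}_2(\mathbb{S}^d,\sigma_d)$-orthonormal family of real spherical harmonics of exact degree $\ell$, where $Z(d,\ell)=(2\ell+d-1)\frac{\Gamma(\ell+d-1)}{\Gamma(d)\Gamma(\ell+1)}$, and let $\lambda_\ell=\ell(\ell+d-1)$, $\ell\ge 0$. For $f\in \mathbb{L}_2(\mathbb{S}^d)$ put $\widehat f_{\ell,k}=\int_{\mathbb{S}^d} f\,Y_{\ell,k}\,\mathrm{d}\sigma_d$. For $s>d/2$ the Sobolev space $\mathbb{H}^s(\mathbb{S}^d)$ is the set of $f\in \mathbb{L}_2(\mathbb{S}^d)$ with $\sum_{\ell=0}^\infty\sum_{k=1}^{Z(d,\ell)}(1+\lambda_\ell)^s|\widehat f_{\ell,k}|^2<\infty$ (embedded in $C(\mathbb{S}^d)$). It is equipped with a norm $\|f\|_{\mathbb{H}^s}=\big[\sum_{\ell=0}^\infty\sum_{k=1}^{Z(d,\ell)}\frac{1}{a_\ell^{(s)}}|\widehat f_{\ell,k}|^2\big]^{1/2}$,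 where $(a_\ell^{(s)})_{\ell\ge0}$ is a fixed sequence of positive reals with $a_\ell^{(s)}\asymp(1+\lambda_\ell)^{-s}$. Here $a_n\asymp b_n$ means $c_1a_n\le b_n\le c_2a_n$ for all $n$ with positive constants $c_1,c_2$ independent of $n$. Different admissible sequences give equivalent norms, so the notion of QMC design below does not depend on the choice. A sequence $(X_N)$ of $N$-point configurations on $\mathbb{S}^d$ (defined for $N$ in some infinite subset of the natural numbers, $N\to\infty$) is a sequence of QMC designs for $\mathbb{H}^s(\mathbb{S}^d)$, $s>d/2$, if there exists $c(s,d)>0$ independent of $N$ such that $$\sup_{f\in\mathbb{H}^s(\mathbb{S}^d),\ \|f\|_{\mathbb{H}^s}\le1}\Big|\frac1N\sum_{\mathbf{x}\in X_N}f(\mathbf{x})-\int_{\mathbb{S}^d}f\,\mathrm{d}\sigma_d\Big|\le\frac{c(s,d)}{N^{s/d}}.$$ *)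

theory Defs
  imports "HOL-Analysis.Analysis" "HOL-Library.Multiset"
begin

text \<open>
  The sphere of dimension \<open>d\<close> is \<open>sphere 0 1\<close> in a Euclidean space with \<open>DIM('a) = d + 1\<close>.
  Functions on it are functions on \<open>'a\<close> of which only the values on \<open>sphere 0 1\<close> matter.
\<close>

text \<open>
  The normalized surface measure as cone measure: a Borel set \<open>A\<close> of unit vectors has measure
  \<open>vol {r *\<^sub>R x | x \<in> A \<and> 0 < r < 1} / vol (ball 0 1)\<close>.
  The restriction makes the sphere the whole space, so that measurability and integrals of a
  function do not depend on its values off the sphere.
\<close>

definition sphere_measure :: "'a::euclidean_space measure" where
  "sphere_measure =
     restrict_space (distr (uniform_measure lborel (ball 0 1)) borel sgn) (sphere 0 1)"

definition laplacian :: "('a::euclidean_space \<Rightarrow> real) \<Rightarrow> 'a \<Rightarrow> real" where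
  "laplacian p x = (\<Sum>b\<in>Basis. (deriv ^^ 2) (\<lambda>t. p (x + t *\<^sub>R b)) 0)"

definition spherical_harmonic :: "nat \<Rightarrow> ('a::euclidean_space \<Rightarrow> real) \<Rightarrow> bool" where
  "spherical_harmonic l Y \<longleftrightarrow>
     (\<exists>p. real_polynomial_function p \<and>
          (\<forall>c x. p (c *\<^sub>R x) = c ^ l * p x) \<and>
          (\<forall>x. laplacian p x = 0) \<and>
          (\<forall>x\<in>sphere 0 1. Y x = p x))"

definition harm_dim :: "nat \<Rightarrow> nat \<Rightarrow> nat" where
  "harm_dim d l =
     nat \<lfloor>(2 * real l + real d - 1) *
          (Gamma (real l + real d - 1) / (Gamma (real d) * Gamma (real l + 1)))\<rfloor>"

text \<open>The floor only converts the type:\<close>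

lemma real_harm_dim:
  assumes "d \<ge> 2"
  shows "real (harm_dim d l) =
           (2 * real l + real d - 1) *
           (Gamma (real l + real d - 1) / (Gamma (real d) * Gamma (real l + 1)))"
proof -
  obtain e where d: "d = e + 2"
    using assms by (metis add.commute le_iff_add)
  have g1: "Gamma (real l + real d - 1) = fact (l + e)"
    using Gamma_fact[of "l + e", where 'a = real] by (simp add: d algebra_simps)
  have g2: "Gamma (real d) = fact (e + 1)"
    using Gamma_fact[of "e + 1", where 'a = real] by (simp add: d algebra_simps)
  have g3: "Gamma (real l + 1) = fact l"
    using Gamma_fact[of l, where 'a = real] by (simp add: algebra_simps)
  have b1: "real ((l + e + 1) choose l) = fact (l + e + 1) / (fact l * fact (e + 1))"
    by (subst binomial_fact) (auto simp: algebra_simps)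
  have b2: "real ((l + e) choose (e + 1)) = real l * fact (l + e) / (fact l * fact (e + 1))"
  proof (cases l)
    case (Suc m)
    have "real ((l + e) choose (e + 1)) = fact (l + e) / (fact (e + 1) * fact m)"
      by (subst binomial_fact) (auto simp: Suc)
    also have "\<dots> = real l * fact (l + e) / (real l * (fact m * fact (e + 1)))"
      by (simp add: Suc del: fact_Suc of_nat_Suc)
    finally show ?thesis
      by (simp add: Suc mult.assoc del: of_nat_Suc)
  qed simp
  have "(2 * real l + real d - 1) *
        (Gamma (real l + real d - 1) / (Gamma (real d) * Gamma (real l + 1))) =
        real (((l + e + 1) choose l) + ((l + e) choose (e + 1)))"
    unfolding g1 g2 g3 of_nat_add b1 b2
    by (simp add: d add_divide_distrib [symmetric] algebra_simps)
  then show ?thesis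
    unfolding harm_dim_def by simp
qed

definition orthonormal_harmonics ::
    "nat \<Rightarrow> (nat \<Rightarrow> nat \<Rightarrow> 'a::euclidean_space \<Rightarrow> real) \<Rightarrow> bool" where
  "orthonormal_harmonics d Y \<longleftrightarrow>
     (\<forall>l. (\<forall>k\<in>{1..harm_dim d l}. spherical_harmonic l (Y l k)) \<and>
          (\<forall>j\<in>{1..harm_dim d l}. \<forall>k\<in>{1..harm_dim d l}.
             (LINT x|sphere_measure. Y l j x * Y l k x) = (if j = k then 1 else 0)))"

definition eigenval :: "nat \<Rightarrow> nat \<Rightarrow> real" where
  "eigenval d l = real l * (real l + real d - 1)"

definition fourier_coeff ::
    "(nat \<Rightarrow> nat \<Rightarrow> 'a::euclidean_space \<Rightarrow> real) \<Rightarrow> ('a \<Rightarrow> real) \<Rightarrow> nat \<Rightarrow> nat \<Rightarrow> real" where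
  "fourier_coeff Y f l k = (LINT x|sphere_measure. f x * Y l k x)"

definition sphere_L2 :: "('a::euclidean_space \<Rightarrow> real) set" where
  "sphere_L2 = {f \<in> borel_measurable sphere_measure. integrable sphere_measure (\<lambda>x. (f x)\<^sup>2)}"

definition sobolev_space ::
    "nat \<Rightarrow> (nat \<Rightarrow> nat \<Rightarrow> 'a::euclidean_space \<Rightarrow> real) \<Rightarrow> real \<Rightarrow> ('a \<Rightarrow> real) set" where
  "sobolev_space d Y s =
     {f \<in> sphere_L2.
        summable (\<lambda>l. \<Sum>k=1..harm_dim d l. (1 + eigenval d l) powr s * (fourier_coeff Y f l k)\<^sup>2)}"

definition admissible_weights :: "nat \<Rightarrow> real \<Rightarrow> (nat \<Rightarrow> real) \<Rightarrow> bool" where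
  "admissible_weights d s a \<longleftrightarrow>
     (\<forall>l. a l > 0) \<and>
     (\<exists>c1>0. \<exists>c2>0. \<forall>l. c1 * a l \<le> (1 + eigenval d l) powr (- s) \<and>
                        (1 + eigenval d l) powr (- s) \<le> c2 * a l)"

definition sobolev_norm ::
    "nat \<Rightarrow> (nat \<Rightarrow> nat \<Rightarrow> 'a::euclidean_space \<Rightarrow> real) \<Rightarrow> (nat \<Rightarrow> real) \<Rightarrow> ('a \<Rightarrow> real) \<Rightarrow> real" where
  "sobolev_norm d Y a f =
     sqrt (\<Sum>l. \<Sum>k=1..harm_dim d l. 1 / a l * (fourier_coeff Y f l k)\<^sup>2)"

text \<open>
  For \<open>s > d/2\<close> every class in the Sobolev space has a unique continuous representative, and
  point evaluation of the class means evaluation of this representative. Hence the supremum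
  runs over the continuous functions in \<open>sobolev_space\<close>. It is taken in \<^typ>\<open>ereal\<close> because on
  \<^typ>\<open>real\<close> the supremum of an unbounded set is unspecified.
\<close>

definition worst_case_error ::
    "nat \<Rightarrow> (nat \<Rightarrow> nat \<Rightarrow> 'a::euclidean_space \<Rightarrow> real) \<Rightarrow> (nat \<Rightarrow> real) \<Rightarrow> real \<Rightarrow> 'a multiset \<Rightarrow> ereal"
  where
  "worst_case_error d Y a s P =
     (SUP f\<in>{f \<in> sobolev_space d Y s. continuous_on (sphere 0 1) f \<and> sobolev_norm d Y a f \<le> 1}.
        ereal \<bar>1 / real (size P) * (\<Sum>x\<in>#P. f x) - (LINT x|sphere_measure. f x)\<bar>)"

text \<open>
  A sequence of configurations is a function \<open>X\<close> of which only the values on the infinite index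
  set \<open>I\<close> matter. Configurations are multisets, so repeated points are allowed.
\<close>

definition configuration_sequence :: "nat set \<Rightarrow> (nat \<Rightarrow> 'a::euclidean_space multiset) \<Rightarrow> bool" where
  "configuration_sequence I X \<longleftrightarrow>
     infinite I \<and> 0 \<notin> I \<and> (\<forall>N\<in>I. size (X N) = N \<and> set_mset (X N) \<subseteq> sphere 0 1)"

definition qmc_designs ::
    "nat \<Rightarrow> (nat \<Rightarrow> nat \<Rightarrow> 'a::euclidean_space \<Rightarrow> real) \<Rightarrow> (nat \<Rightarrow> real) \<Rightarrow> real \<Rightarrow>
     nat set \<Rightarrow> (nat \<Rightarrow> 'a multiset) \<Rightarrow> bool" where
  "qmc_designs d Y a s I X \<longleftrightarrow>
     configuration_sequence I X \<and>
     (\<exists>c>0. \<forall>N\<in>I. worst_case_error d Y a s (X N) \<le> ereal (c / real N powr (s / real d)))"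

end

theory Submission imports Defs begin

text \<open>
  Write \<open>err f\<close> for the average of \<open>f\<close> over an \<open>N\<close>-point configuration minus its integral, and
  \<open>defect l\<close> for the sum of \<open>(err (Y l k))\<^sup>2\<close> over \<open>k\<close>. By duality the worst-case error in smoothness
  \<open>s\<close> is the square root of \<open>\<Sum>l. w l powr (- s) * defect l\<close>, up to constants, where
  \<open>w l = 1 + eigenval d l\<close> is of order \<open>(1 + l)\<^sup>2\<close>. Lowering \<open>s\<close> to \<open>s'\<close> gives more weight to high degrees.
  Degrees below \<open>N powr (1/d)\<close> are harmless, since there \<open>w l powr (- s')\<close> exceeds \<open>w l powr (- s)\<close> by a
  factor of at most the order of \<open>N powr (2 * (s - s') / d)\<close>. For the others one needs the defects up
  to degree \<open>L\<close> to add up to \<open>O (L ^ d / N)\<close>; summing over dyadic blocks then uses \<open>s' > d / 2\<close>.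

  This growth bound is where positivity of the quadrature weights enters, through the Poisson kernel
  \<open>P r x y = (1 - r\<^sup>2) / norm (r *\<^sub>R x - y) ^ (d + 1)\<close>. Convolution with it multiplies harmonics of degree
  \<open>l\<close> by \<open>r ^ l\<close>, so the average of \<open>P r x y\<close> over all pairs of nodes is \<open>1 + \<Sum>l. r ^ l * defect l\<close>
  (\<open>defect_generating_function\<close>). For \<open>1 - r\<close> of order \<open>N powr (- 1/d)\<close> the hypothesis bounds this average
  by a constant, because \<open>r ^ l\<close> is dominated by \<open>(1 - r) powr (- 2 * s) * w l powr (- s)\<close>. The
  pointwise inequality \<open>P r' \<le> 2 * ((1 - r) / (1 - r')) ^ d * P r\<close> for \<open>r \<le> r'\<close>
  (\<open>poisson_comparison\<close>) can be averaged over pairs of nodes and carries the bound over to \<open>r'\<close>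
  closer to \<open>1\<close>, that is, to higher degrees (\<open>damped_defect_bound\<close>). A purely
  real-variable argument then finishes the estimate (\<open>dyadic_energy_bound\<close>).

  A continuous function that only has smoothness \<open>s'\<close> is replaced by its Poisson integral, which is as smooth
  as desired and converges to it uniformly as \<open>r\<close> tends to \<open>1\<close> (\<open>error_le_of_defect_bound\<close>).

  Errors are expanded in harmonics by the hypothesis itself: the remainder of a function after removal
  of its first harmonics has small Sobolev norm, hence small error, so \<open>err\<close> may be expanded term by
  term whether or not the expansion of the function converges to it (\<open>error_sums\<close>).

  The multiplier property of the Poisson kernel comes from the maximum principle in the unit ball.
  The kernel is harmonic in its first argument, so its integral against a function on the sphere is
  harmonic as well; harmonicity is phrased by second differences, which pass through
  integrals by a uniform Taylor estimate. Orthogonality of different degrees follows from the multiplier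
  property and the symmetry of the kernel.
\<close>

section \<open>Rotation invariance of the surface measure\<close>

text \<open>
  Both \<open>lborel\<close> and its image are translation invariant and agree on the unit ball, so this is
  uniqueness of Haar measure. The uniqueness argument is Weil's: integrate \<open>f (T x) * g (y)\<close>, shear the second
  variable by \<open>T x\<close>, exchange the integrals, and translate back; with \<open>g\<close> the indicator of the ball,
  the common factor cancels.
\<close>

lemma lborel_orthogonal_invariant:
  fixes T :: "'a::euclidean_space \<Rightarrow> 'a"
  assumes T: "orthogonal_transformation T"
  shows "distr lborel borel T = lborel"
proof (rule measure_eqI)
  fix A :: "'a set" assume "A \<in> sets (distr lborel borel T)"
  then have A[measurable]: "A \<in> sets borel" by simp
  have lin: "linear T" using T by (simp add: orthogonal_transformation_def)
  have meas[measurable]: "T \<in> borel_measurable borel"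
    using lin by (intro borel_measurable_continuous_onI linear_continuous_on)
      (simp add: linear_conv_bounded_linear)
  obtain S where S: "\<And>y. T (S y) = y"
    using orthogonal_transformation_surj[OF T] by (metis surjD)
  define f g :: "'a \<Rightarrow> ennreal" where "f = indicator A" and "g = indicator (ball 0 1)"
  have [measurable]: "f \<in> borel_measurable borel" "g \<in> borel_measurable borel"
    unfolding f_def g_def by (auto intro!: borel_measurable_indicator borel_open)
  have shift: "(\<integral>\<^sup>+y. F (y + c) \<partial>lborel) = (\<integral>\<^sup>+y. F y \<partial>lborel)"
    if [measurable]: "F \<in> borel_measurable borel" for F :: "'a \<Rightarrow> ennreal" and c
    by (subst (2) lborel_distr_plus[of c, symmetric], subst nn_integral_distr)
      (simp_all add: add.commute)
  have refl: "(\<integral>\<^sup>+y. F (c - y) \<partial>lborel) = (\<integral>\<^sup>+y. F y \<partial>lborel)"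
    if [measurable]: "F \<in> borel_measurable borel" for F :: "'a \<Rightarrow> ennreal" and c
  proof -
    have "lborel = distr lborel borel (\<lambda>y. c - y)"
      using lborel_affine[of "-1" c] by (simp add: density_1)
    then have "(\<integral>\<^sup>+y. F y \<partial>lborel) = (\<integral>\<^sup>+y. F y \<partial>distr lborel borel (\<lambda>y. c - y))" by simp
    then show ?thesis by (simp add: nn_integral_distr)
  qed
  have "(\<integral>\<^sup>+x. f (T x) \<partial>lborel) * (\<integral>\<^sup>+y. g y \<partial>lborel)
      = (\<integral>\<^sup>+x. \<integral>\<^sup>+y. f (T x) * g y \<partial>lborel \<partial>lborel)"
    by (simp add: nn_integral_cmult nn_integral_multc)
  also have "\<dots> = (\<integral>\<^sup>+x. \<integral>\<^sup>+y. f (T x) * g (y + T x) \<partial>lborel \<partial>lborel)"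
    by (rule nn_integral_cong, rule shift[of "\<lambda>y. f (T x) * g y" "T x" for x, symmetric]) measurable
  also have "\<dots> = (\<integral>\<^sup>+y. \<integral>\<^sup>+x. f (T x) * g (y + T x) \<partial>lborel \<partial>lborel)"
    by (rule lborel_pair.Fubini'[symmetric]) measurable
  also have "\<dots> = (\<integral>\<^sup>+y. \<integral>\<^sup>+x. f (T x - y) * g (T x) \<partial>lborel \<partial>lborel)"
  proof (rule nn_integral_cong)
    fix y
    have "(\<integral>\<^sup>+x. f (T x - y) * g (T x) \<partial>lborel) = (\<integral>\<^sup>+x. f (T (x + S y) - y) * g (T (x + S y)) \<partial>lborel)"
      by (rule shift[of "\<lambda>x. f (T x - y) * g (T x)" "S y", symmetric]) measurable
    then show "(\<integral>\<^sup>+x. f (T x) * g (y + T x) \<partial>lborel) = (\<integral>\<^sup>+x. f (T x - y) * g (T x) \<partial>lborel)"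
      by (simp add: linear_add[OF lin] S add.commute)
  qed
  also have "\<dots> = (\<integral>\<^sup>+x. \<integral>\<^sup>+y. f (T x - y) * g (T x) \<partial>lborel \<partial>lborel)"
    by (rule lborel_pair.Fubini') measurable
  also have "\<dots> = (\<integral>\<^sup>+x. g (T x) \<partial>lborel) * (\<integral>\<^sup>+y. f y \<partial>lborel)"
    by (simp add: nn_integral_cmult nn_integral_multc refl mult.commute)
  also have "(\<lambda>x. g (T x)) = g"
    using T by (auto simp: g_def orthogonal_transformation_norm indicator_def)
  finally have "emeasure lborel (T -` A) * emeasure lborel (ball (0::'a) 1)
      = emeasure lborel A * emeasure lborel (ball (0::'a) 1)"
    using measurable_sets[OF meas A]
    by (simp add: f_def g_def indicator_vimage[symmetric] comp_def mult.commute)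
  moreover have "emeasure lborel (ball (0::'a) 1) \<noteq> 0" "emeasure lborel (ball (0::'a) 1) < \<infinity>"
    using content_ball_pos[of 1 "0::'a"] emeasure_bounded_finite[of "ball (0::'a) 1"]
    by (auto simp: measure_def)
  ultimately show "emeasure (distr lborel borel T) A = emeasure lborel A"
    by (auto simp: emeasure_distr ennreal_mult_cancel_left mult.commute[of _ "emeasure lborel (ball (0::'a) 1)"])
qed simp

lemma space_sphere_measure [simp]:
  "space (sphere_measure :: 'a::euclidean_space measure) = sphere 0 1"
  by (simp add: sphere_measure_def space_restrict_space)

lemma sets_sphere_measure [measurable_cong]:
  "sets (sphere_measure :: 'a::euclidean_space measure) = sets (restrict_space borel (sphere 0 1))"
  by (simp add: sphere_measure_def sets_restrict_space)

lemma borel_measurable_sgn_euclidean [measurable]: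
  "(sgn :: 'a::euclidean_space \<Rightarrow> 'a) \<in> borel_measurable borel"
  unfolding sgn_div_norm[abs_def] by measurable

lemma emeasure_sphere_measure_space:
  "emeasure (sphere_measure :: 'a::euclidean_space measure) (sphere 0 1) = 1"
proof -
  have fin: "emeasure lborel (ball (0::'a) 1) \<noteq> 0" "emeasure lborel (ball (0::'a) 1) \<noteq> \<infinity>"
    using content_ball_pos[of 1 "0::'a"] emeasure_bounded_finite[of "ball (0::'a) 1"]
    by (auto simp: measure_def)
  have "sgn -` sphere 0 1 = - {0::'a}"
    by (auto simp: norm_sgn split: if_splits)
  then have "emeasure (sphere_measure :: 'a measure) (sphere 0 1)
      = emeasure (uniform_measure lborel (ball (0::'a) 1)) (- {0})"
    by (simp add: sphere_measure_def emeasure_restrict_space emeasure_distr)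
  also have "\<dots> = emeasure lborel (ball (0::'a) 1 - {0}) / emeasure lborel (ball (0::'a) 1)"
    by (simp add: Diff_eq)
  also have "emeasure lborel (ball (0::'a) 1 - {0}) = emeasure lborel (ball (0::'a) 1)"
    by (intro emeasure_Diff_null_set) (auto simp: null_sets_def)
  finally show ?thesis
    using fin by (simp add: ennreal_divide_self top.not_eq_extremum)
qed

lemma finite_measure_sphere_measure:
  "finite_measure (sphere_measure :: 'a::euclidean_space measure)"
  by (rule finite_measureI) (simp add: emeasure_sphere_measure_space)

lemma measure_sphere_measure_space [simp]:
  "measure (sphere_measure :: 'a::euclidean_space measure) (sphere 0 1) = 1"
  by (simp add: measure_def emeasure_sphere_measure_space)

lemma integral_sphere_measure_const [simp]:
  "(LINT x|(sphere_measure :: 'a::euclidean_space measure). (c::real)) = c"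
  by simp

lemma borel_measurable_sphere_continuous:
  assumes "continuous_on (sphere 0 1) f"
  shows "f \<in> borel_measurable (sphere_measure :: 'a::euclidean_space measure)"
  using borel_measurable_continuous_on_restrict[OF assms]
  by (simp add: measurable_cong_sets[OF sets_sphere_measure refl])

lemma sphere_bound_continuous:
  fixes f :: "'a::euclidean_space \<Rightarrow> real"
  assumes "continuous_on (sphere 0 1) f"
  obtains B where "B > 0" "\<And>x. x \<in> sphere 0 1 \<Longrightarrow> \<bar>f x\<bar> \<le> B"
proof -
  have "compact (f ` sphere 0 1)"
    using assms by (intro compact_continuous_image) auto
  then obtain B where "B > 0" "\<forall>y\<in>f ` sphere 0 1. norm y \<le> B"
    using compact_imp_bounded bounded_pos by blast
  then show ?thesis using that by auto
qed

lemma integrable_sphere_continuous: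
  fixes f :: "'a::euclidean_space \<Rightarrow> real"
  assumes "continuous_on (sphere 0 1) f"
  shows "integrable sphere_measure f"
proof -
  obtain B where "\<And>x. x \<in> sphere 0 1 \<Longrightarrow> \<bar>f x\<bar> \<le> B"
    using sphere_bound_continuous[OF assms] by blast
  then show ?thesis
    by (intro finite_measure.integrable_const_bound[where B = B] finite_measure_sphere_measure
        borel_measurable_sphere_continuous assms AE_I2) auto
qed

text \<open>
  An orthogonal map preserves the unit ball and commutes with radial projection, so the cone
  construction transports the invariance of Lebesgue measure to the sphere.
\<close>

lemma integral_sphere_orthogonal_invariant:
  fixes f :: "'a::euclidean_space \<Rightarrow> real" and T :: "'a \<Rightarrow> 'a"
  assumes T: "orthogonal_transformation T" and f: "continuous_on (sphere 0 1) f"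
  shows "(LINT x|sphere_measure. f (T x)) = (LINT x|sphere_measure. f x)"
proof -
  let ?S = "sphere 0 1 :: 'a set" and ?B = "ball 0 1 :: 'a set"
  have lin: "linear T" and nT: "norm (T x) = norm x" for x
    using T by (auto simp: orthogonal_transformation_def orthogonal_transformation_norm)
  have contT: "continuous_on X T" for X
    using lin by (intro linear_continuous_on) (simp add: linear_conv_bounded_linear)
  have [measurable]: "T \<in> borel_measurable borel"
    by (intro borel_measurable_continuous_onI contT)
  have S[measurable]: "?S \<in> sets borel" by simp
  have meas: "(\<lambda>x. indicator ?S x * g x) \<in> borel_measurable borel" if "continuous_on ?S g" for g :: "'a \<Rightarrow> real"
    using borel_measurable_continuous_on_restrict[OF that] by (simp add: borel_measurable_restrict_space_iff)
  have formula: "(LINT x|sphere_measure. g x) =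
      (LINT z|lborel. indicator ?B z * (indicator ?S (sgn z) * g (sgn z))) / measure lborel ?B"
    if g: "continuous_on ?S g" for g :: "'a \<Rightarrow> real"
  proof -
    note [measurable] = meas[OF g]
    have "(LINT x|sphere_measure. g x) =
        (LINT x|distr (uniform_measure lborel ?B) borel sgn. indicator ?S x * g x)"
      unfolding sphere_measure_def by (subst integral_restrict_space) auto
    also have "\<dots> = (LINT z|uniform_measure lborel ?B. indicator ?S (sgn z) * g (sgn z))"
      by (subst integral_distr) auto
    also have "\<dots> = (LINT z|lborel. indicator ?B z * (indicator ?S (sgn z) * g (sgn z))) / measure lborel ?B"
    proof -
      have B: "emeasure lborel ?B = ennreal (measure lborel ?B)"
        by (rule emeasure_eq_ennreal_measure) (use emeasure_bounded_finite[of ?B] in auto)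
      have "uniform_measure lborel ?B = density lborel (\<lambda>z. ennreal (indicator ?B z / measure lborel ?B))"
        unfolding uniform_measure_def B using content_ball_pos[of 1 "0::'a"]
        by (intro density_cong) (auto simp: divide_ennreal indicator_def simp flip: ennreal_1)
      then show ?thesis
        using measurable_compose[OF borel_measurable_sgn_euclidean meas[OF g]] content_ball_pos[of 1 "0::'a"]
        by (simp only:, subst integral_density)
          (auto intro!: borel_measurable_divide borel_measurable_indicator)
    qed
    finally show ?thesis .
  qed
  have fT: "continuous_on ?S (\<lambda>x. f (T x))"
    by (intro continuous_on_compose2[OF f contT]) (auto simp: nT)
  have sgnT: "sgn (T z) = T (sgn z)" for z
    by (simp add: sgn_div_norm nT linear_scale[OF lin])
  let ?F = "\<lambda>z. indicator ?B z * (indicator ?S (sgn z) * f (sgn z)) :: real"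
  have "?F \<in> borel_measurable borel"
    by (intro borel_measurable_times borel_measurable_indicator
        measurable_compose[OF borel_measurable_sgn_euclidean meas[OF f]]) auto
  then have "(LINT z|lborel. ?F z) = (LINT z|lborel. ?F (T z))"
    by (subst lborel_orthogonal_invariant[OF T, symmetric]) (simp add: integral_distr)
  also have "\<dots> = (LINT z|lborel. indicator ?B z * (indicator ?S (sgn z) * f (T (sgn z))))"
    by (intro Bochner_Integration.integral_cong) (auto simp: sgnT nT indicator_def)
  finally show ?thesis
    by (simp add: formula[OF f] formula[OF fT])
qed

section \<open>Second differences and the maximum principle\<close>

definition second_difference :: "('a::euclidean_space \<Rightarrow> real) \<Rightarrow> 'a \<Rightarrow> real \<Rightarrow> real" where
  "second_difference u x t = (\<Sum>b\<in>Basis. u (x + t *\<^sub>R b) + u (x - t *\<^sub>R b) - 2 * u x)"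

text \<open>
  The second difference replaces the Laplacian: it is \<open>t\<^sup>2\<close> times the Laplacian up to \<open>o (t\<^sup>2)\<close>, so that
  this condition means a vanishing Laplacian for smooth functions, yet it can be verified for an integral
  without differentiating under the integral sign.
\<close>

definition weakly_harmonic_at :: "('a::euclidean_space \<Rightarrow> real) \<Rightarrow> 'a \<Rightarrow> bool" where
  "weakly_harmonic_at u x \<longleftrightarrow>
     (\<forall>e>0. \<forall>\<^sub>F t in at_right 0. \<bar>second_difference u x t\<bar> \<le> e * t\<^sup>2)"

lemma weakly_harmonic_at_uminus:
  "weakly_harmonic_at u x \<Longrightarrow> weakly_harmonic_at (\<lambda>x. - u x) x"
proof -
  have "second_difference (\<lambda>x. - u x) x t = - second_difference u x t" for t
    unfolding second_difference_def sum_negf[symmetric] by (intro sum.cong) auto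
  then show "weakly_harmonic_at u x \<Longrightarrow> weakly_harmonic_at (\<lambda>x. - u x) x"
    by (simp add: weakly_harmonic_at_def)
qed

lemma weakly_harmonic_at_diff:
  assumes "weakly_harmonic_at u x" "weakly_harmonic_at v x"
  shows "weakly_harmonic_at (\<lambda>x. u x - v x) x"
  unfolding weakly_harmonic_at_def
proof (intro allI impI)
  fix e :: real assume "e > 0"
  then have "e / 2 > 0" by simp
  then have "\<forall>\<^sub>F t in at_right 0. \<bar>second_difference u x t\<bar> \<le> e / 2 * t\<^sup>2"
    "\<forall>\<^sub>F t in at_right 0. \<bar>second_difference v x t\<bar> \<le> e / 2 * t\<^sup>2"
    using assms unfolding weakly_harmonic_at_def by blast+
  then show "\<forall>\<^sub>F t in at_right 0. \<bar>second_difference (\<lambda>x. u x - v x) x t\<bar> \<le> e * t\<^sup>2"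
  proof eventually_elim
    case (elim t)
    have "second_difference (\<lambda>x. u x - v x) x t = second_difference u x t - second_difference v x t"
      unfolding second_difference_def sum_subtractf[symmetric] by (intro sum.cong) auto
    then show ?case using elim by linarith
  qed
qed

text \<open>
  At an interior maximum of \<open>u y + e * (norm y)\<^sup>2\<close> all second differences of this function are
  nonpositive. Their sum, however, is that of \<open>u\<close>, which is \<open>o (t\<^sup>2)\<close>, plus \<open>2 * e * DIM('a) * t\<^sup>2\<close>.
\<close>

lemma weak_maximum_principle:
  fixes u :: "'a::euclidean_space \<Rightarrow> real"
  assumes cont: "continuous_on (cball 0 R) u"
    and harm: "\<And>x. x \<in> ball 0 R \<Longrightarrow> weakly_harmonic_at u x"
    and bound: "\<And>x. x \<in> sphere 0 R \<Longrightarrow> u x \<le> M"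
    and x: "x \<in> cball 0 R"
  shows "u x \<le> M"
proof (rule ccontr)
  assume "\<not> u x \<le> M"
  then have gap: "u x - M > 0" by simp
  define e where "e = (u x - M) / (2 * (R\<^sup>2 + 1))"
  have e: "e > 0" using gap by (simp add: e_def add_nonneg_pos)
  have eR: "e * R\<^sup>2 < u x - M"
  proof -
    have "e * R\<^sup>2 \<le> e * (R\<^sup>2 + 1)" using e by simp
    also have "\<dots> = (u x - M) / 2"
      using add_nonneg_pos[of "R\<^sup>2" 1] by (simp add: e_def field_simps)
    also have "\<dots> < u x - M" using gap by simp
    finally show ?thesis .
  qed
  define w where "w y = u y + e * (norm y)\<^sup>2" for y
  have "continuous_on (cball 0 R) w"
    unfolding w_def by (intro continuous_intros cont)
  then obtain z where z: "z \<in> cball 0 R" and max: "\<And>y. y \<in> cball 0 R \<Longrightarrow> w y \<le> w z"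
    using continuous_attains_sup[of "cball 0 R" w] x by (metis compact_cball empty_iff)
  have "z \<notin> sphere 0 R"
  proof
    assume "z \<in> sphere 0 R"
    then have "w z \<le> M + e * R\<^sup>2" using bound[of z] by (auto simp: w_def)
    moreover have "u x \<le> w x" using e by (simp add: w_def)
    ultimately show False using max[OF x] eR by linarith
  qed
  then have zb: "z \<in> ball 0 R" using z by auto
  have "\<forall>\<^sub>F t in at_right 0. \<bar>second_difference u z t\<bar> \<le> e * t\<^sup>2"
    using harm[OF zb] e unfolding weakly_harmonic_at_def by blast
  moreover have "\<forall>\<^sub>F t in at_right 0. t \<in> {0<..<R - norm z}"
    using zb by (intro eventually_at_right_real) simp
  ultimately have "\<forall>\<^sub>F t in at_right 0. \<bar>second_difference u z t\<bar> \<le> e * t\<^sup>2 \<and> t \<in> {0<..<R - norm z}"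
    by (rule eventually_conj)
  then have "\<exists>t. \<bar>second_difference u z t\<bar> \<le> e * t\<^sup>2 \<and> t \<in> {0<..<R - norm z}"
    by (rule eventually_happens'[OF trivial_limit_at_right_real])
  then obtain t where small: "\<bar>second_difference u z t\<bar> \<le> e * t\<^sup>2" and t: "0 < t" "t < R - norm z"
    by auto
  have "second_difference u z t + 2 * e * DIM('a) * t\<^sup>2 = (\<Sum>b\<in>Basis. w (z + t *\<^sub>R b) + w (z - t *\<^sub>R b) - 2 * w z)"
  proof -
    have "w (z + t *\<^sub>R b) + w (z - t *\<^sub>R b) - 2 * w z
        = (u (z + t *\<^sub>R b) + u (z - t *\<^sub>R b) - 2 * u z) + 2 * e * t\<^sup>2" if "b \<in> Basis" for b
    proof -
      have "(norm (z + t *\<^sub>R b))\<^sup>2 + (norm (z - t *\<^sub>R b))\<^sup>2 = 2 * (norm z)\<^sup>2 + 2 * t\<^sup>2"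
        using that unfolding power2_norm_eq_inner
        by (simp add: inner_add_left inner_add_right inner_diff_left inner_diff_right
            inner_commute power2_eq_square)
      then have "e * (norm (z + t *\<^sub>R b))\<^sup>2 + e * (norm (z - t *\<^sub>R b))\<^sup>2 = e * (2 * (norm z)\<^sup>2 + 2 * t\<^sup>2)"
        by (metis distrib_left)
      then show ?thesis unfolding w_def by (simp add: algebra_simps)
    qed
    then show ?thesis by (simp add: second_difference_def sum.distrib)
  qed
  also have "\<dots> \<le> 0"
  proof (rule sum_nonpos)
    fix b :: 'a assume b: "b \<in> Basis"
    have "norm (z + t *\<^sub>R b) \<le> norm z + t" "norm (z - t *\<^sub>R b) \<le> norm z + t"
      using norm_triangle_ineq[of z "t *\<^sub>R b"] norm_triangle_ineq4[of z "t *\<^sub>R b"] b t by auto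
    then have "w (z + t *\<^sub>R b) \<le> w z" "w (z - t *\<^sub>R b) \<le> w z"
      using t by (auto intro!: max)
    then show "w (z + t *\<^sub>R b) + w (z - t *\<^sub>R b) - 2 * w z \<le> 0" by linarith
  qed
  finally have "2 * e * DIM('a) * t\<^sup>2 \<le> e * t\<^sup>2"
    using small by linarith
  moreover have "e * t\<^sup>2 * 1 < e * t\<^sup>2 * (2 * real DIM('a))"
  proof (rule mult_strict_left_mono)
    have "1 \<le> DIM('a)" by (simp add: Suc_leI)
    then show "1 < 2 * real DIM('a)" by linarith
    show "0 < e * t\<^sup>2" using e t by simp
  qed
  ultimately show False by (simp add: mult_ac)
qed

lemma weak_maximum_principle_abs:
  fixes u :: "'a::euclidean_space \<Rightarrow> real"
  assumes cont: "continuous_on (cball 0 R) u"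
    and harm: "\<And>x. x \<in> ball 0 R \<Longrightarrow> weakly_harmonic_at u x"
    and bound: "\<And>x. x \<in> sphere 0 R \<Longrightarrow> \<bar>u x\<bar> \<le> M"
    and x: "x \<in> cball 0 R"
  shows "\<bar>u x\<bar> \<le> M"
proof -
  have "u x \<le> M"
    by (rule weak_maximum_principle[OF cont harm _ x]) (use bound in force)+
  moreover have "- u x \<le> M"
    by (rule weak_maximum_principle[OF continuous_on_minus[OF cont] weakly_harmonic_at_uminus[OF harm] _ x])
      (use bound in force)+
  ultimately show ?thesis by linarith
qed

text \<open>
  The error is controlled by the oscillation of the second derivative alone. For a family of
  functions with equicontinuous second derivatives the estimate is therefore uniform, which lets it pass under
  an integral.
\<close>

lemma second_difference_Taylor:
  fixes g g' g'' :: "real \<Rightarrow> real"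
  assumes t: "0 < t"
    and g': "\<And>s. \<bar>s\<bar> \<le> t \<Longrightarrow> (g has_real_derivative g' s) (at s)"
    and g'': "\<And>s. \<bar>s\<bar> \<le> t \<Longrightarrow> (g' has_real_derivative g'' s) (at s)"
    and near: "\<And>s. \<bar>s\<bar> \<le> t \<Longrightarrow> \<bar>g'' s - g'' 0\<bar> \<le> e"
  shows "\<bar>g t + g (- t) - 2 * g 0 - g'' 0 * t\<^sup>2\<bar> \<le> e * t\<^sup>2"
proof -
  define diff where "diff m = (if m = 0 then g else if m = 1 then g' else g'')" for m :: nat
  have D: "\<forall>m s. m < 2 \<and> \<bar>s\<bar> \<le> t \<longrightarrow> (diff m has_real_derivative diff (Suc m) s) (at s)"
  proof (intro allI impI)
    fix m :: nat and s :: real assume *: "m < 2 \<and> \<bar>s\<bar> \<le> t"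
    then consider "m = 0" | "m = 1" by linarith
    then show "(diff m has_real_derivative diff (Suc m) s) (at s)"
      using * g' g'' by cases (auto simp: diff_def)
  qed
  have T: "\<exists>s. \<bar>s\<bar> \<le> t \<and> g r = g 0 + g' 0 * r + g'' s / 2 * r\<^sup>2" if r: "\<bar>r\<bar> = t" for r
  proof -
    have "\<exists>s. \<bar>s\<bar> \<le> \<bar>r\<bar> \<and> g r = (\<Sum>m<2. diff m 0 / fact m * r ^ m) + diff 2 s / fact 2 * r ^ 2"
      by (rule Maclaurin_bi_le) (use D r in \<open>auto simp: diff_def\<close>)
    then show ?thesis
      using r by (auto simp: diff_def numeral_2_eq_2)
  qed
  obtain s1 s2 where s: "\<bar>s1\<bar> \<le> t" "g t = g 0 + g' 0 * t + g'' s1 / 2 * t\<^sup>2"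
      "\<bar>s2\<bar> \<le> t" "g (- t) = g 0 + g' 0 * (- t) + g'' s2 / 2 * (- t)\<^sup>2"
    using T[of t] T[of "- t"] t by auto
  have "g t + g (- t) - 2 * g 0 - g'' 0 * t\<^sup>2 = ((g'' s1 - g'' 0) + (g'' s2 - g'' 0)) / 2 * t\<^sup>2"
    unfolding s by (simp add: field_simps)
  also have "\<bar>\<dots>\<bar> = \<bar>((g'' s1 - g'' 0) + (g'' s2 - g'' 0)) / 2\<bar> * t\<^sup>2"
    by (simp add: abs_mult)
  also have "\<dots> \<le> e * t\<^sup>2"
    using near[OF s(1)] near[OF s(3)] by (intro mult_right_mono) auto
  finally show ?thesis .
qed

lemma weakly_harmonic_at_polynomial:
  fixes p :: "'a::euclidean_space \<Rightarrow> real"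
  assumes p: "real_polynomial_function p" and harm: "laplacian p x = 0"
  shows "weakly_harmonic_at p x"
  unfolding weakly_harmonic_at_def
proof (intro allI impI)
  fix e :: real assume e: "e > 0"
  define e' where "e' = e / DIM('a)"
  have e': "e' > 0" using e by (simp add: e'_def)
  let ?D = "\<lambda>b. (deriv ^^ 2) (\<lambda>t. p (x + t *\<^sub>R b)) 0"
  have ev: "\<forall>\<^sub>F t in at_right 0.
      \<bar>p (x + t *\<^sub>R b) + p (x - t *\<^sub>R b) - 2 * p x - ?D b * t\<^sup>2\<bar> \<le> e' * t\<^sup>2" for b
  proof -
    define g where "g t = p (x + t *\<^sub>R b)" for t
    have "polynomial_function (\<lambda>t::real. x + t *\<^sub>R b)"
      by (intro polynomial_function_add polynomial_function_mult) auto
    then have "real_polynomial_function (p \<circ> (\<lambda>t. x + t *\<^sub>R b))"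
      by (rule real_polynomial_function_compose[OF _ p])
    then have "real_polynomial_function g" by (simp add: g_def[abs_def] comp_def)
    then obtain g' where g': "real_polynomial_function g'" "\<And>t. (g has_real_derivative g' t) (at t)"
      using has_real_derivative_polynomial_function by blast
    then obtain g'' where g'': "real_polynomial_function g''" "\<And>t. (g' has_real_derivative g'' t) (at t)"
      using has_real_derivative_polynomial_function by blast
    have "deriv g = g'" "deriv g' = g''"
      using g'(2) g''(2) by (auto intro!: DERIV_imp_deriv)
    then have D: "?D b = g'' 0"
      by (simp add: g_def[abs_def, symmetric] numeral_2_eq_2)
    have "isCont g'' 0"
      using continuous_real_polymonial_function[OF g''(1)] .
    then obtain d where d: "d > 0" "\<And>s. \<bar>s\<bar> < d \<Longrightarrow> \<bar>g'' s - g'' 0\<bar> < e'"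
      using e' unfolding continuous_at_eps_delta by (metis dist_real_def diff_zero)
    have "\<forall>\<^sub>F t in at_right 0. t \<in> {0<..<d}"
      by (rule eventually_at_right_real) (use d in simp)
    then show ?thesis
    proof eventually_elim
      case (elim t)
      have "\<bar>g t + g (- t) - 2 * g 0 - g'' 0 * t\<^sup>2\<bar> \<le> e' * t\<^sup>2"
        by (rule second_difference_Taylor[OF _ g'(2) g''(2)]) (use elim d(2) in \<open>auto intro: less_imp_le\<close>)
      then show ?case by (simp add: D) (simp add: g_def)
    qed
  qed
  have "\<forall>\<^sub>F t in at_right 0. \<forall>b\<in>Basis.
      \<bar>p (x + t *\<^sub>R b) + p (x - t *\<^sub>R b) - 2 * p x - ?D b * t\<^sup>2\<bar> \<le> e' * t\<^sup>2"
    by (rule eventually_ball_finite) (use ev in auto)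
  then show "\<forall>\<^sub>F t in at_right 0. \<bar>second_difference p x t\<bar> \<le> e * t\<^sup>2"
  proof eventually_elim
    case (elim t)
    have "second_difference p x t = (\<Sum>b\<in>Basis. p (x + t *\<^sub>R b) + p (x - t *\<^sub>R b) - 2 * p x - ?D b * t\<^sup>2)"
      using harm unfolding laplacian_def second_difference_def
      by (simp add: sum_subtractf flip: sum_distrib_right)
    also have "\<bar>\<dots>\<bar> \<le> (\<Sum>b\<in>(Basis::'a set). e' * t\<^sup>2)"
      by (rule order.trans[OF sum_abs sum_mono]) (use elim in blast)
    also have "\<dots> = e * t\<^sup>2" by (simp add: e'_def)
    finally show ?case .
  qed
qed

section \<open>The Poisson kernel and Poisson integrals\<close>

text \<open>
  Only points \<open>x\<close> of the open ball and \<open>y\<close> of the sphere matter. For \<open>norm x = r\<close> this is the kernel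
  whose convolution multiplies harmonics of degree \<open>l\<close> by \<open>r ^ l\<close>.
\<close>

definition poisson :: "'a::euclidean_space \<Rightarrow> 'a \<Rightarrow> real" where
  "poisson x y = (1 - (norm x)\<^sup>2) / norm (x - y) ^ DIM('a)"

lemma ball_neq_sphere: "x \<in> ball 0 1 \<Longrightarrow> y \<in> sphere 0 1 \<Longrightarrow> (x::'a::real_normed_vector) \<noteq> y"
  by auto

lemma poisson_pos: "x \<in> ball 0 1 \<Longrightarrow> y \<in> sphere 0 1 \<Longrightarrow> 0 < poisson x y"
  unfolding poisson_def by (intro divide_pos_pos zero_less_power) (auto simp: power_less_one_iff)

lemma continuous_on_poisson:
  assumes "continuous_on S f" "continuous_on S g"
    and "\<And>s. s \<in> S \<Longrightarrow> f s \<in> ball 0 1" "\<And>s. s \<in> S \<Longrightarrow> g s \<in> sphere 0 1"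
  shows "continuous_on S (\<lambda>s. poisson (f s) (g s))"
  unfolding poisson_def
  by (intro continuous_intros assms) (use ball_neq_sphere assms(3,4) in fastforce)

text \<open>
  With the squared distance as base, the kernel restricted to a line becomes a quadratic polynomial times a
  real power of a quadratic polynomial.
\<close>

lemma poisson_powr:
  fixes x y :: "'a::euclidean_space"
  assumes "x \<noteq> y"
  shows "poisson x y = (1 - x \<bullet> x) * ((x - y) \<bullet> (x - y)) powr (- (DIM('a) / 2))"
proof -
  have "(x - y) \<bullet> (x - y) = norm (x - y) powr 2"
    using assms by (simp add: dot_square_norm)
  then have "((x - y) \<bullet> (x - y)) powr (DIM('a) / 2) = (norm (x - y) powr 2) powr (DIM('a) / 2)"
    by (simp only:)
  also have "\<dots> = norm (x - y) powr real DIM('a)"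
    unfolding powr_powr by simp
  also have "\<dots> = norm (x - y) ^ DIM('a)"
    using assms by (intro powr_realpow) simp
  finally show ?thesis
    unfolding poisson_def powr_minus divide_inverse power2_norm_eq_inner by (simp only:)
qed

text \<open>
  The kernel \<open>poisson (x + s *\<^sub>R b) y\<close> as a function of \<open>s\<close>, with \<open>m = DIM('a) / 2\<close>, \<open>A = 1 - (norm x)\<^sup>2\<close>,
  \<open>xb = x \<bullet> b\<close>, \<open>D = (norm (x - y))\<^sup>2\<close> and \<open>wb = (x - y) \<bullet> b\<close>; the next two functions are its derivatives.
\<close>

definition line_kernel :: "real \<Rightarrow> real \<Rightarrow> real \<Rightarrow> real \<Rightarrow> real \<Rightarrow> real \<Rightarrow> real" where
  "line_kernel m A xb D wb s = (A - 2 * s * xb - s\<^sup>2) * (D + 2 * s * wb + s\<^sup>2) powr (- m)"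

definition line_kernel' :: "real \<Rightarrow> real \<Rightarrow> real \<Rightarrow> real \<Rightarrow> real \<Rightarrow> real \<Rightarrow> real" where
  "line_kernel' m A xb D wb s =
     (- 2 * xb - 2 * s) * (D + 2 * s * wb + s\<^sup>2) powr (- m)
     + (A - 2 * s * xb - s\<^sup>2) * (- m * (D + 2 * s * wb + s\<^sup>2) powr (- m - 1) * (2 * wb + 2 * s))"

definition line_kernel'' :: "real \<Rightarrow> real \<Rightarrow> real \<Rightarrow> real \<Rightarrow> real \<Rightarrow> real \<Rightarrow> real" where
  "line_kernel'' m A xb D wb s =
     - 2 * (D + 2 * s * wb + s\<^sup>2) powr (- m)
     + 2 * (- 2 * xb - 2 * s) * (- m * (D + 2 * s * wb + s\<^sup>2) powr (- m - 1) * (2 * wb + 2 * s))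
     + (A - 2 * s * xb - s\<^sup>2)
       * (m * (m + 1) * (D + 2 * s * wb + s\<^sup>2) powr (- m - 2) * (2 * wb + 2 * s)\<^sup>2
          - 2 * m * (D + 2 * s * wb + s\<^sup>2) powr (- m - 1))"

lemma line_kernel_derivatives:
  assumes "D + 2 * s * wb + s\<^sup>2 > 0"
  shows "(line_kernel m A xb D wb has_real_derivative line_kernel' m A xb D wb s) (at s)"
    and "(line_kernel' m A xb D wb has_real_derivative line_kernel'' m A xb D wb s) (at s)"
proof -
  let ?q = "\<lambda>s. D + 2 * s * wb + s\<^sup>2"
  have q: "((\<lambda>s. ?q s powr c) has_real_derivative c * ?q s powr (c - 1) * (2 * wb + 2 * s)) (at s)" for c
  proof -
    have "(?q has_real_derivative 2 * wb + 2 * s) (at s)"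
      by (auto intro!: derivative_eq_intros)
    from DERIV_chain2[OF has_real_derivative_powr[OF assms] this] show ?thesis .
  qed
  have l: "((\<lambda>s. A - 2 * s * xb - s\<^sup>2) has_real_derivative - 2 * xb - 2 * s) (at s)"
    "((\<lambda>s. - 2 * xb - 2 * s) has_real_derivative - 2) (at s)"
    "((\<lambda>s. 2 * wb + 2 * s) has_real_derivative 2) (at s)"
    by (auto intro!: derivative_eq_intros)
  show "(line_kernel m A xb D wb has_real_derivative line_kernel' m A xb D wb s) (at s)"
    unfolding line_kernel_def[abs_def] line_kernel'_def
    by (rule DERIV_cong[OF DERIV_mult[OF l(1) q]]) (simp add: algebra_simps)
  show "(line_kernel' m A xb D wb has_real_derivative line_kernel'' m A xb D wb s) (at s)"
    unfolding line_kernel'_def[abs_def] line_kernel''_def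
    by (rule DERIV_cong[OF DERIV_add[OF DERIV_mult[OF l(2) q]
          DERIV_mult[OF l(1) DERIV_mult[OF DERIV_cmult[OF q] l(3)]]]])
      (simp add: algebra_simps power2_eq_square)
qed

lemma poisson_line:
  fixes x y b :: "'a::euclidean_space"
  assumes "b \<in> Basis" "x + s *\<^sub>R b \<noteq> y"
  shows "poisson (x + s *\<^sub>R b) y = line_kernel (DIM('a) / 2) (1 - x \<bullet> x) (x \<bullet> b)
           ((x - y) \<bullet> (x - y)) ((x - y) \<bullet> b) s"
    and "((x - y) \<bullet> (x - y)) + 2 * s * ((x - y) \<bullet> b) + s\<^sup>2 > 0"
proof -
  have b: "b \<bullet> b = 1" using assms(1) by simp
  have n: "(x + s *\<^sub>R b) \<bullet> (x + s *\<^sub>R b) = x \<bullet> x + 2 * s * (x \<bullet> b) + s\<^sup>2" for x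
    using b by (simp add: inner_add_left inner_add_right inner_commute power2_eq_square)
  have eq: "x + s *\<^sub>R b - y = (x - y) + s *\<^sub>R b" by simp
  show "poisson (x + s *\<^sub>R b) y = line_kernel (DIM('a) / 2) (1 - x \<bullet> x) (x \<bullet> b)
           ((x - y) \<bullet> (x - y)) ((x - y) \<bullet> b) s"
    unfolding poisson_powr[OF assms(2)] eq n line_kernel_def by (simp add: algebra_simps)
  have "x + s *\<^sub>R b - y \<noteq> 0" using assms(2) by simp
  then show "((x - y) \<bullet> (x - y)) + 2 * s * ((x - y) \<bullet> b) + s\<^sup>2 > 0"
    unfolding n[symmetric] eq by simp
qed

text \<open>
  With \<open>m = DIM('a) / 2\<close> the sum is a multiple of \<open>2 * (x \<bullet> w) + (1 - x \<bullet> x) - w \<bullet> w\<close> for \<open>w = x - y\<close>,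
  which vanishes for unit vectors \<open>y\<close>.
\<close>

lemma poisson_harmonic:
  fixes x y :: "'a::euclidean_space"
  assumes "x \<noteq> y" "norm y = 1"
  shows "(\<Sum>b\<in>Basis. line_kernel'' (DIM('a) / 2) (1 - x \<bullet> x) (x \<bullet> b)
           ((x - y) \<bullet> (x - y)) ((x - y) \<bullet> b) 0) = 0"
proof -
  define m where "m = real DIM('a) / 2"
  define A where "A = 1 - x \<bullet> x"
  define w where "w = x - y"
  define D where "D = w \<bullet> w"
  have D: "D > 0" using assms(1) by (simp add: D_def w_def)
  define c where "c = D powr (- m - 1)"
  have "D powr (- m) = D powr (1 + (- m - 1))"
    by (rule arg_cong[of _ _ "\<lambda>z. D powr z"]) simp
  also have "\<dots> = D powr 1 * c"
    unfolding c_def by (rule powr_add)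
  finally have c1: "D powr (- m) = D * c"
    using D by simp
  have "D powr (- m - 2) = D powr ((- m - 1) - 1)"
    by (rule arg_cong[of _ _ "\<lambda>z. D powr z"]) simp
  also have "\<dots> = c / D powr 1"
    unfolding c_def by (rule powr_diff)
  finally have c2: "D powr (- m - 2) = c / D"
    using D by simp
  have "(\<Sum>b\<in>Basis. line_kernel'' m A (x \<bullet> b) D (w \<bullet> b) 0) =
    (\<Sum>b\<in>(Basis::'a set). (- 2 * D * c - 2 * m * A * c) + (8 * m * c) * ((x \<bullet> b) * (w \<bullet> b))
       + (4 * A * m * (m + 1) * c / D) * ((w \<bullet> b) * (w \<bullet> b)))"
    unfolding line_kernel''_def
    by (intro sum.cong) (simp_all add: c1 c2 c_def[symmetric] power2_eq_square algebra_simps add_divide_distrib)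
  also have "\<dots> = (- 2 * D * c - 2 * m * A * c) * (2 * m) + (8 * m * c) * (x \<bullet> w)
       + (4 * A * m * (m + 1) * c / D) * D"
  proof -
    have "(\<Sum>b\<in>Basis. (w \<bullet> b) * (w \<bullet> b)) = D" "(\<Sum>b\<in>Basis. (x \<bullet> b) * (w \<bullet> b)) = x \<bullet> w"
      unfolding D_def by (rule euclidean_inner[symmetric])+
    then show ?thesis
      unfolding sum.distrib sum_distrib_left[symmetric] by (simp add: m_def)
  qed
  also have "\<dots> = 4 * m * c * (2 * (x \<bullet> w) + A - D)"
    using D by (simp add: field_simps)
  also have "2 * (x \<bullet> w) + A - D = 0"
  proof -
    have "y \<bullet> y = 1" using assms(2) by (simp add: dot_square_norm)
    then show ?thesis
      by (simp add: A_def D_def w_def inner_diff_left inner_diff_right inner_commute)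
  qed
  finally show ?thesis by (simp add: m_def A_def D_def w_def)
qed

text \<open>
  The second derivatives along coordinate lines are jointly continuous in the line parameter and in
  \<open>y\<close>, hence uniformly continuous on a compact set; this makes the Taylor estimate uniform in \<open>y\<close>.
\<close>

lemma poisson_second_difference_uniform:
  fixes x :: "'a::euclidean_space"
  assumes x: "x \<in> ball 0 1" and e: "e > 0"
  shows "\<forall>\<^sub>F t in at_right 0. \<forall>y\<in>sphere 0 1.
           \<bar>second_difference (\<lambda>z. poisson z y) x t\<bar> \<le> e * t\<^sup>2"
proof -
  define e' where "e' = e / DIM('a)"
  have e': "e' > 0" using e by (simp add: e'_def)
  \<comment> \<open>Segments of length \<open>\<tau>\<close> around \<open>x\<close> stay away from the sphere, where the kernel is singular.\<close>
  define \<tau> where "\<tau> = (1 - norm x) / 2"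
  have \<tau>: "\<tau> > 0" "norm x + \<tau> < 1" using x by (simp_all add: \<tau>_def field_simps)
  let ?G = "\<lambda>b s y. line_kernel'' (DIM('a) / 2) (1 - x \<bullet> x) (x \<bullet> b) ((x - y) \<bullet> (x - y)) ((x - y) \<bullet> b) s"
  have off: "x + s *\<^sub>R b \<noteq> y" if "b \<in> Basis" "\<bar>s\<bar> \<le> \<tau>" "y \<in> sphere 0 1" for b s y
  proof
    assume "x + s *\<^sub>R b = y"
    then have "norm y \<le> norm x + \<bar>s\<bar>"
      using norm_triangle_ineq[of x "s *\<^sub>R b"] that(1) by auto
    then show False using that \<tau> by simp
  qed
  have ev: "\<forall>\<^sub>F t in at_right 0. \<forall>y\<in>sphere 0 1.
      \<bar>poisson (x + t *\<^sub>R b) y + poisson (x - t *\<^sub>R b) y - 2 * poisson x y - ?G b 0 y * t\<^sup>2\<bar> \<le> e' * t\<^sup>2"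
    if b: "b \<in> Basis" for b
  proof -
    let ?K = "cball 0 \<tau> \<times> sphere 0 1 :: (real \<times> 'a) set"
    have pos: "(x - snd v) \<bullet> (x - snd v) + 2 * fst v * ((x - snd v) \<bullet> b) + (fst v)\<^sup>2 \<noteq> 0" if "v \<in> ?K" for v
      using poisson_line(2)[OF b off[OF b]] that by (metis dist_0_norm less_irrefl mem_Times_iff mem_cball real_norm_def)
    have "continuous_on ?K (\<lambda>v. ?G b (fst v) (snd v))"
      unfolding line_kernel''_def by (intro continuous_intros) (use pos in auto)
    moreover have "compact ?K" by (intro compact_Times) auto
    ultimately have "uniformly_continuous_on ?K (\<lambda>v. ?G b (fst v) (snd v))"
      using compact_uniformly_continuous by blast
    then obtain \<delta> where \<delta>: "\<delta> > 0"
      "\<And>u v. u \<in> ?K \<Longrightarrow> v \<in> ?K \<Longrightarrow> dist v u < \<delta> \<Longrightarrow> \<bar>?G b (fst v) (snd v) - ?G b (fst u) (snd u)\<bar> < e'"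
      using e' unfolding uniformly_continuous_on_def dist_real_def by meson
    have "\<forall>\<^sub>F t in at_right 0. t \<in> {0<..<min \<delta> \<tau>}"
      by (rule eventually_at_right_real) (use \<delta> \<tau> in simp)
    then show ?thesis
    proof (eventually_elim, intro ballI)
      fix t :: real and y :: 'a assume t: "t \<in> {0<..<min \<delta> \<tau>}" and y: "y \<in> sphere 0 1"
      let ?L = "line_kernel (DIM('a) / 2) (1 - x \<bullet> x) (x \<bullet> b) ((x - y) \<bullet> (x - y)) ((x - y) \<bullet> b)"
      have L: "poisson (x + s *\<^sub>R b) y = ?L s" if "\<bar>s\<bar> \<le> \<tau>" for s
        using poisson_line(1)[OF b off[OF b that y]] .
      have "\<bar>?L t + ?L (- t) - 2 * ?L 0 - ?G b 0 y * t\<^sup>2\<bar> \<le> e' * t\<^sup>2"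
      proof (rule second_difference_Taylor[OF _ line_kernel_derivatives])
        show "0 < t" using t by simp
        fix s :: real assume "\<bar>s\<bar> \<le> t"
        then have s: "\<bar>s\<bar> \<le> \<tau>" "\<bar>s\<bar> < \<delta>" using t by auto
        show "0 < (x - y) \<bullet> (x - y) + 2 * s * ((x - y) \<bullet> b) + s\<^sup>2"
          "0 < (x - y) \<bullet> (x - y) + 2 * s * ((x - y) \<bullet> b) + s\<^sup>2"
          using poisson_line(2)[OF b off[OF b s(1) y]] by auto
        show "\<bar>?G b s y - ?G b 0 y\<bar> \<le> e'"
          using \<delta>(2)[of "(0, y)" "(s, y)"] s y \<tau> by (simp add: dist_Pair_Pair)
      qed
      then show "\<bar>poisson (x + t *\<^sub>R b) y + poisson (x - t *\<^sub>R b) y - 2 * poisson x y - ?G b 0 y * t\<^sup>2\<bar> \<le> e' * t\<^sup>2"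
        using L[of t] L[of "- t"] L[of 0] t by simp
    qed
  qed
  have "\<forall>\<^sub>F t in at_right 0. \<forall>b\<in>Basis. \<forall>y\<in>sphere 0 1.
      \<bar>poisson (x + t *\<^sub>R b) y + poisson (x - t *\<^sub>R b) y - 2 * poisson x y - ?G b 0 y * t\<^sup>2\<bar> \<le> e' * t\<^sup>2"
    by (rule eventually_ball_finite) (use ev in auto)
  then show ?thesis
  proof (eventually_elim, intro ballI)
    fix t :: real and y :: 'a
    assume *: "\<forall>b\<in>Basis. \<forall>y\<in>sphere 0 1.
      \<bar>poisson (x + t *\<^sub>R b) y + poisson (x - t *\<^sub>R b) y - 2 * poisson x y - ?G b 0 y * t\<^sup>2\<bar> \<le> e' * t\<^sup>2"
      and y: "y \<in> sphere 0 1"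
    have "(\<Sum>b\<in>Basis. ?G b 0 y) = 0"
      using poisson_harmonic[OF ball_neq_sphere[OF x y]] y by simp
    then have "second_difference (\<lambda>z. poisson z y) x t = (\<Sum>b\<in>Basis. poisson (x + t *\<^sub>R b) y
        + poisson (x - t *\<^sub>R b) y - 2 * poisson x y - ?G b 0 y * t\<^sup>2)"
      unfolding second_difference_def by (simp add: sum_subtractf flip: sum_distrib_right)
    also have "\<bar>\<dots>\<bar> \<le> (\<Sum>b\<in>(Basis::'a set). e' * t\<^sup>2)"
      by (rule order.trans[OF sum_abs sum_mono]) (use * y in blast)
    also have "\<dots> = e * t\<^sup>2" by (simp add: e'_def)
    finally show "\<bar>second_difference (\<lambda>z. poisson z y) x t\<bar> \<le> e * t\<^sup>2" .
  qed
qed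

lemma abs_integral_sphere_le:
  fixes f g :: "'a::euclidean_space \<Rightarrow> real"
  assumes "continuous_on (sphere 0 1) f" "continuous_on (sphere 0 1) g"
    and "\<And>y. y \<in> sphere 0 1 \<Longrightarrow> \<bar>f y\<bar> \<le> g y"
  shows "\<bar>LINT y|sphere_measure. f y\<bar> \<le> (LINT y|sphere_measure. g y)"
proof -
  have "\<bar>LINT y|sphere_measure. f y\<bar> \<le> (LINT y|sphere_measure. \<bar>f y\<bar>)"
    by (rule integral_abs_bound)
  also have "\<dots> \<le> (LINT y|sphere_measure. g y)"
    by (rule Bochner_Integration.integral_mono)
      (use assms in \<open>auto intro!: integrable_sphere_continuous continuous_intros\<close>)
  finally show ?thesis .
qed

lemma continuous_on_sphere_integral:
  fixes F :: "'b::metric_space \<Rightarrow> 'a::euclidean_space \<Rightarrow> real"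
  assumes K: "compact K" and F: "continuous_on (K \<times> sphere 0 1) (\<lambda>v. F (fst v) (snd v))"
  shows "continuous_on K (\<lambda>x. LINT y|sphere_measure. F x y)"
  unfolding continuous_on_iff
proof (intro ballI allI impI)
  fix x and e :: real assume x: "x \<in> K" and e: "0 < e"
  have slice: "continuous_on (sphere 0 1) (F z)" if "z \<in> K" for z
  proof -
    have "continuous_on (sphere 0 1) (\<lambda>y::'a. (z, y))"
      by (intro continuous_intros)
    from continuous_on_compose2[OF F this] show ?thesis
      using that by fastforce
  qed
  have "uniformly_continuous_on (K \<times> sphere 0 1) (\<lambda>v. F (fst v) (snd v))"
    by (intro compact_uniformly_continuous F compact_Times K) auto
  then obtain d where d: "d > 0" "\<And>u v. u \<in> K \<times> sphere 0 1 \<Longrightarrow> v \<in> K \<times> sphere 0 1 \<Longrightarrow> dist v u < d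
      \<Longrightarrow> \<bar>F (fst v) (snd v) - F (fst u) (snd u)\<bar> < e / 2"
    using e unfolding uniformly_continuous_on_def dist_real_def by (meson half_gt_zero)
  show "\<exists>d>0. \<forall>x'\<in>K. dist x' x < d \<longrightarrow>
      dist (LINT y|sphere_measure. F x' y) (LINT y|sphere_measure. F x y) < e"
  proof (intro exI[of _ d] conjI ballI impI d(1))
    fix x' assume x': "x' \<in> K" "dist x' x < d"
    have "\<bar>LINT y|sphere_measure. F x' y - F x y\<bar> \<le> (LINT y|(sphere_measure::'a measure). e / 2)"
    proof (rule abs_integral_sphere_le)
      fix y :: 'a assume "y \<in> sphere 0 1"
      then show "\<bar>F x' y - F x y\<bar> \<le> e / 2"
        using d(2)[of "(x, y)" "(x', y)"] x x' by (simp add: dist_Pair_Pair)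
    qed (intro continuous_intros slice x x')+
    then show "dist (LINT y|sphere_measure. F x' y) (LINT y|sphere_measure. F x y) < e"
      using e slice[OF x] slice[OF x'(1)]
      by (simp add: dist_real_def integrable_sphere_continuous Bochner_Integration.integral_diff)
  qed
qed

definition poisson_integral :: "('a::euclidean_space \<Rightarrow> real) \<Rightarrow> 'a \<Rightarrow> real" where
  "poisson_integral f x = (LINT y|sphere_measure. poisson x y * f y)"

lemma continuous_on_poisson_mult:
  assumes "continuous_on (sphere 0 1) f" "x \<in> ball 0 1"
  shows "continuous_on (sphere 0 1) (\<lambda>y. poisson x y * f y)"
  by (intro continuous_intros continuous_on_poisson assms) (use assms in auto)

lemma continuous_on_poisson_integral:
  fixes f :: "'a::euclidean_space \<Rightarrow> real"
  assumes f: "continuous_on (sphere 0 1) f" and K: "compact K" "K \<subseteq> ball 0 1"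
  shows "continuous_on K (poisson_integral f)"
  unfolding poisson_integral_def[abs_def]
proof (rule continuous_on_sphere_integral[OF K(1)])
  show "continuous_on (K \<times> sphere 0 1) (\<lambda>v. poisson (fst v) (snd v) * f (snd v))"
    by (intro continuous_intros continuous_on_poisson continuous_on_compose2[OF f])
      (use K in auto)
qed

lemma poisson_integral_harmonic:
  fixes f :: "'a::euclidean_space \<Rightarrow> real"
  assumes f: "continuous_on (sphere 0 1) f" and x: "x \<in> ball 0 1"
  shows "weakly_harmonic_at (poisson_integral f) x"
  unfolding weakly_harmonic_at_def
proof (intro allI impI)
  fix e :: real assume e: "e > 0"
  obtain B where B: "B > 0" "\<And>y. y \<in> sphere 0 1 \<Longrightarrow> \<bar>f y\<bar> \<le> B"
    using sphere_bound_continuous[OF f] by blast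
  have "\<forall>\<^sub>F t in at_right 0. \<forall>y\<in>sphere 0 1.
      \<bar>second_difference (\<lambda>z. poisson z y) x t\<bar> \<le> (e / B) * t\<^sup>2"
    by (rule poisson_second_difference_uniform[OF x]) (use e B in simp)
  moreover have "\<forall>\<^sub>F t in at_right 0. t \<in> {0<..<1 - norm x}"
    by (rule eventually_at_right_real) (use x in simp)
  ultimately show "\<forall>\<^sub>F t in at_right 0. \<bar>second_difference (poisson_integral f) x t\<bar> \<le> e * t\<^sup>2"
  proof eventually_elim
    case (elim t)
    have inb: "x + t *\<^sub>R b \<in> ball 0 1" "x - t *\<^sub>R b \<in> ball 0 1" if "b \<in> Basis" for b
      using norm_triangle_ineq[of x "t *\<^sub>R b"] norm_triangle_ineq4[of x "t *\<^sub>R b"] that elim by auto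
    note int = integrable_sphere_continuous[OF continuous_on_poisson_mult[OF f]]
    have I: "integrable sphere_measure (\<lambda>y. poisson (x + t *\<^sub>R b) y * f y)"
        "integrable sphere_measure (\<lambda>y. poisson (x - t *\<^sub>R b) y * f y)"
        "integrable sphere_measure (\<lambda>y. 2 * (poisson x y * f y))" if "b \<in> Basis" for b
      using int[OF inb(1)[OF that]] int[OF inb(2)[OF that]] int[OF x] by auto
    have "second_difference (poisson_integral f) x t
        = (LINT y|sphere_measure. (\<Sum>b\<in>Basis. poisson (x + t *\<^sub>R b) y * f y + poisson (x - t *\<^sub>R b) y * f y
            - 2 * (poisson x y * f y)))"
    proof (subst Bochner_Integration.integral_sum)
      show "second_difference (poisson_integral f) x t
        = (\<Sum>b\<in>Basis. LINT y|sphere_measure. poisson (x + t *\<^sub>R b) y * f y + poisson (x - t *\<^sub>R b) y * f y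
            - 2 * (poisson x y * f y))"
        unfolding second_difference_def poisson_integral_def
      proof (rule sum.cong[OF refl])
        fix b :: 'a assume b: "b \<in> Basis"
        show "(LINT y|sphere_measure. poisson (x + t *\<^sub>R b) y * f y) + (LINT y|sphere_measure. poisson (x - t *\<^sub>R b) y * f y)
            - 2 * (LINT y|sphere_measure. poisson x y * f y)
          = (LINT y|sphere_measure. poisson (x + t *\<^sub>R b) y * f y + poisson (x - t *\<^sub>R b) y * f y
            - 2 * (poisson x y * f y))"
          using I[OF b] by (simp only: Bochner_Integration.integral_diff Bochner_Integration.integral_add
            Bochner_Integration.integrable_add integral_mult_right_zero)
      qed
    qed (use I in \<open>auto intro!: Bochner_Integration.integrable_diff Bochner_Integration.integrable_add\<close>)
    also have "\<dots> = (LINT y|sphere_measure. second_difference (\<lambda>z. poisson z y) x t * f y)"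
      unfolding second_difference_def sum_distrib_right
      by (intro Bochner_Integration.integral_cong refl sum.cong) (simp add: algebra_simps)
    also have "\<bar>\<dots>\<bar> \<le> (LINT y|(sphere_measure::'a measure). e * t\<^sup>2)"
    proof (rule abs_integral_sphere_le)
      show "continuous_on (sphere 0 1) (\<lambda>y. second_difference (\<lambda>z. poisson z y) x t * f y)"
        unfolding second_difference_def
        by (intro continuous_intros continuous_on_poisson f) (use inb x in auto)
      fix y :: 'a assume y: "y \<in> sphere 0 1"
      have "\<bar>second_difference (\<lambda>z. poisson z y) x t * f y\<bar> \<le> ((e / B) * t\<^sup>2) * B"
        unfolding abs_mult by (intro mult_mono) (use elim y B e in auto)
      then show "\<bar>second_difference (\<lambda>z. poisson z y) x t * f y\<bar> \<le> e * t\<^sup>2"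
        using B by simp
    qed simp
    finally show ?case by simp
  qed
qed

text \<open>
  The reflection in the hyperplane orthogonal to \<open>x - x'\<close>; for \<open>x = x'\<close> division by zero turns the
  formula into the identity.
\<close>

lemma orthogonal_transformation_of_norm_eq:
  fixes x x' :: "'a::euclidean_space"
  assumes "norm x = norm x'"
  obtains T :: "'a \<Rightarrow> 'a" where "orthogonal_transformation T" "T x = x'"
proof -
  define w where "w = x - x'"
  define T :: "'a \<Rightarrow> 'a" where "T z = z - (2 * (z \<bullet> w) / (w \<bullet> w)) *\<^sub>R w" for z
  have "linear T"
    unfolding T_def
    by (rule linearI)
      (simp_all add: inner_add_left add_divide_distrib scaleR_left_distrib distrib_left
        scaleR_right_diff_distrib mult.left_commute)
  moreover have "T u \<bullet> T v = u \<bullet> v" for u v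
  proof (cases "w = 0")
    case False
    define k where "k z = 2 * (z \<bullet> w) / (w \<bullet> w)" for z
    have k: "k z * (w \<bullet> w) = 2 * (z \<bullet> w)" for z
      using False by (simp add: k_def)
    have "T u \<bullet> T v = u \<bullet> v - k v * (u \<bullet> w) - k u * (v \<bullet> w) + k u * (k v * (w \<bullet> w))"
      unfolding T_def k_def[symmetric] inner_diff_left inner_diff_right inner_scaleR_left inner_scaleR_right
        inner_commute[of w v] by algebra
    also have "\<dots> = u \<bullet> v - k v * (u \<bullet> w) + k u * (v \<bullet> w)"
      unfolding k by simp
    also have "\<dots> = u \<bullet> v" by (simp add: k_def)
    finally show ?thesis .
  qed (simp add: T_def)
  moreover have "T x = x'"
  proof (cases "w = 0")
    case False
    then have ww: "w \<bullet> w \<noteq> 0" by simp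
    have "x \<bullet> x = x' \<bullet> x'" using assms by (metis dot_square_norm)
    then have "2 * (x \<bullet> w) = w \<bullet> w"
      by (simp add: w_def inner_diff_left inner_diff_right inner_commute)
    then show ?thesis using ww by (simp add: T_def) (simp add: w_def)
  qed (simp add: T_def w_def)
  ultimately show ?thesis
    using that unfolding orthogonal_transformation_def by blast
qed

text \<open>
  The integral is harmonic in \<open>x\<close> and, by rotation invariance, constant on spheres around the origin.
  The maximum principle makes it constant on balls, and at the origin the kernel equals \<open>1\<close>.
\<close>

lemma integral_poisson:
  fixes x :: "'a::euclidean_space"
  assumes x: "x \<in> ball 0 1"
  shows "(LINT y|sphere_measure. poisson x y) = 1"
proof -
  define u where "u = poisson_integral (\<lambda>_::'a. 1)"
  have u: "u z = (LINT y|sphere_measure. poisson z y)" for z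
    by (simp add: u_def poisson_integral_def)
  have rot: "u z = u x" if z: "z \<in> sphere 0 (norm x)" for z
  proof -
    obtain T :: "'a \<Rightarrow> 'a" where T: "orthogonal_transformation T" "T x = z"
      using orthogonal_transformation_of_norm_eq[of x z] z by auto
    have inv: "poisson z (T y) = poisson x y" for y
    proof -
      have lin: "linear T" and n: "norm (T v) = norm v" for v
        using T(1) by (auto simp: orthogonal_transformation_def orthogonal_transformation_norm)
      have "norm (T x - T y) = norm (x - y)"
        using n[of "x - y"] by (simp add: linear_diff[OF lin])
      then show ?thesis using n[of x] by (simp add: poisson_def T(2))
    qed
    have "u z = (LINT y|sphere_measure. poisson z (T y))"
      unfolding u by (rule integral_sphere_orthogonal_invariant[OF T(1), symmetric])
        (intro continuous_on_poisson continuous_intros, use z x in auto)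
    then show ?thesis by (simp add: inv u)
  qed
  have "\<bar>u 0 - u x\<bar> \<le> 0"
  proof (rule weak_maximum_principle_abs[where R = "norm x" and u = "\<lambda>z. u z - u x"])
    show "continuous_on (cball 0 (norm x)) (\<lambda>z. u z - u x)"
      unfolding u_def by (intro continuous_intros continuous_on_poisson_integral) (use x in auto)
    fix z :: 'a assume "z \<in> ball 0 (norm x)"
    then have z: "z \<in> ball 0 1" using x by auto
    have "weakly_harmonic_at (\<lambda>_. u x) z"
      by (simp add: weakly_harmonic_at_def second_difference_def less_imp_le)
    then show "weakly_harmonic_at (\<lambda>z. u z - u x) z"
      unfolding u_def by (intro weakly_harmonic_at_diff poisson_integral_harmonic z) auto
  next
    fix z :: 'a assume "z \<in> sphere 0 (norm x)"
    then show "\<bar>u z - u x\<bar> \<le> 0" using rot[of z] by simp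
  qed simp
  moreover have "u 0 = (LINT y|(sphere_measure::'a measure). 1)"
    unfolding u by (rule Bochner_Integration.integral_cong) (auto simp: poisson_def)
  ultimately show ?thesis by (simp add: u)
qed

text \<open>
  The mass of the kernel concentrates near \<open>x\<close>: at distance at least \<open>\<delta>\<close> it is at most
  \<open>(1 - r\<^sup>2) / (\<delta> / 2) ^ DIM('a)\<close>, and near \<open>x\<close> uniform continuity of \<open>f\<close> applies.
\<close>

lemma poisson_approximate_identity:
  fixes f :: "'a::euclidean_space \<Rightarrow> real"
  assumes f: "continuous_on (sphere 0 1) f" and e: "e > 0"
  shows "\<forall>\<^sub>F r in at_left 1. \<forall>x\<in>sphere 0 1. \<bar>poisson_integral f (r *\<^sub>R x) - f x\<bar> \<le> e"
proof -
  have "uniformly_continuous_on (sphere 0 1) f"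
    by (intro compact_uniformly_continuous f) simp
  then obtain \<delta> where \<delta>: "\<delta> > 0"
      "\<And>x y. x \<in> sphere 0 1 \<Longrightarrow> y \<in> sphere 0 1 \<Longrightarrow> dist y x < \<delta> \<Longrightarrow> \<bar>f y - f x\<bar> < e / 2"
    using e unfolding uniformly_continuous_on_def dist_real_def by (meson half_gt_zero)
  obtain B where B: "B > 0" "\<And>y. y \<in> sphere 0 1 \<Longrightarrow> \<bar>f y\<bar> \<le> B"
    using sphere_bound_continuous[OF f] by blast
  define C where "C = 2 * B / (\<delta> / 2) ^ DIM('a)"
  have "((\<lambda>r::real. (1 - r\<^sup>2) * C) \<longlongrightarrow> (1 - 1\<^sup>2) * C) (at_left 1)"
    by (intro tendsto_intros)
  then have "\<forall>\<^sub>F r::real in at_left 1. (1 - r\<^sup>2) * C < e / 2"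
    by (rule order_tendstoD(2)) (use e in simp)
  moreover have "\<forall>\<^sub>F r in at_left 1. r \<in> {max 0 (1 - \<delta> / 2)<..<1}"
    by (rule eventually_at_left_real) (use \<delta> in simp)
  ultimately show ?thesis
  proof (eventually_elim, intro ballI)
    fix r :: real and x :: 'a
    assume C: "(1 - r\<^sup>2) * C < e / 2" and r: "r \<in> {max 0 (1 - \<delta> / 2)<..<1}" and x: "x \<in> sphere 0 1"
    have rx: "r *\<^sub>R x \<in> ball 0 1" using r x by simp
    have r2: "0 < 1 - r\<^sup>2" using r by (simp add: power_less_one_iff)
    have cont: "continuous_on (sphere 0 1) (poisson (r *\<^sub>R x))"
      using continuous_on_poisson_mult[OF continuous_on_const rx, of 1] by simp
    have "poisson_integral f (r *\<^sub>R x) - f x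
        = (LINT y|sphere_measure. poisson (r *\<^sub>R x) y * f y) - (LINT y|sphere_measure. poisson (r *\<^sub>R x) y * f x)"
      using integral_poisson[OF rx] by (simp add: poisson_integral_def)
    also have "\<dots> = (LINT y|sphere_measure. poisson (r *\<^sub>R x) y * f y - poisson (r *\<^sub>R x) y * f x)"
      by (rule Bochner_Integration.integral_diff[symmetric];
          intro integrable_sphere_continuous continuous_intros cont f)
    also have "\<bar>\<dots>\<bar> \<le> (LINT y|sphere_measure. e / 2 * poisson (r *\<^sub>R x) y + (1 - r\<^sup>2) * C)"
    proof (rule abs_integral_sphere_le)
      fix y :: 'a assume y: "y \<in> sphere 0 1"
      have pos: "poisson (r *\<^sub>R x) y > 0" by (rule poisson_pos[OF rx y])
      have C0: "0 \<le> (1 - r\<^sup>2) * C" using B \<delta> r2 by (simp add: C_def)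
      have eq: "\<bar>poisson (r *\<^sub>R x) y * f y - poisson (r *\<^sub>R x) y * f x\<bar> = poisson (r *\<^sub>R x) y * \<bar>f y - f x\<bar>"
        using pos by (simp add: abs_mult flip: right_diff_distrib)
      show "\<bar>poisson (r *\<^sub>R x) y * f y - poisson (r *\<^sub>R x) y * f x\<bar> \<le> e / 2 * poisson (r *\<^sub>R x) y + (1 - r\<^sup>2) * C"
      proof (cases "dist y x < \<delta>")
        case True
        have "poisson (r *\<^sub>R x) y * \<bar>f y - f x\<bar> \<le> poisson (r *\<^sub>R x) y * (e / 2)"
          using \<delta>(2)[OF x y True] pos by (intro mult_left_mono) auto
        then show ?thesis using C0 unfolding eq by (simp add: mult.commute)
      next
        case False
        have "norm (x - r *\<^sub>R x) = 1 - r"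
        proof -
          have "x - r *\<^sub>R x = (1 - r) *\<^sub>R x" by (simp add: algebra_simps)
          then show ?thesis using r x by simp
        qed
        then have "\<delta> / 2 \<le> norm (r *\<^sub>R x - y)"
          using norm_triangle_ineq[of "x - r *\<^sub>R x" "r *\<^sub>R x - y"] False r
          by (simp add: dist_norm norm_minus_commute)
        then have "poisson (r *\<^sub>R x) y \<le> (1 - r\<^sup>2) / (\<delta> / 2) ^ DIM('a)"
          unfolding poisson_def using \<delta>(1) r2 x ball_neq_sphere[OF rx y]
          by (auto intro!: divide_left_mono power_mono mult_pos_pos zero_less_power)
        moreover have "\<bar>f y - f x\<bar> \<le> 2 * B" using B(2)[OF x] B(2)[OF y] by linarith
        ultimately have "poisson (r *\<^sub>R x) y * \<bar>f y - f x\<bar> \<le> (1 - r\<^sup>2) / (\<delta> / 2) ^ DIM('a) * (2 * B)"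
          using r2 \<delta> by (intro mult_mono) auto
        moreover have "0 \<le> e / 2 * poisson (r *\<^sub>R x) y" using e pos by simp
        ultimately show ?thesis unfolding eq by (simp add: C_def)
      qed
    qed (intro continuous_intros cont f)+
    also have "\<dots> = e / 2 + (1 - r\<^sup>2) * C"
      using integral_poisson[OF rx] integrable_sphere_continuous[OF cont]
      by (simp add: finite_measure.integrable_const[OF finite_measure_sphere_measure])
    also have "\<dots> \<le> e" using C by simp
    finally show "\<bar>poisson_integral f (r *\<^sub>R x) - f x\<bar> \<le> e" .
  qed
qed

section \<open>Spherical harmonics as eigenfunctions of the Poisson integral\<close>

lemma continuous_on_spherical_harmonic:
  assumes "spherical_harmonic l Y"
  shows "continuous_on (sphere 0 1) Y"
proof -
  obtain p where p: "real_polynomial_function p" "\<forall>x\<in>sphere 0 1. Y x = p x"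
    using assms unfolding spherical_harmonic_def by blast
  have "continuous_on (sphere 0 1) p"
    using continuous_on_polymonial_function p(1) by (simp add: real_polynomial_function_eq)
  then show ?thesis
    by (rule continuous_on_eq) (use p(2) in auto)
qed

lemma spherical_harmonic_const: "spherical_harmonic 0 (\<lambda>_. c)"
  unfolding spherical_harmonic_def
proof (intro exI[of _ "\<lambda>_. c"] conjI allI ballI)
  fix x :: 'a
  show "laplacian (\<lambda>_. c) x = 0"
    by (simp add: laplacian_def numeral_2_eq_2)
qed auto

text \<open>
  The Poisson integral and the harmonic polynomial representing \<open>Y\<close> are both harmonic in the ball. On
  spheres of radius close to \<open>1\<close> both are uniformly close to \<open>Y\<close>, so they agree by the maximum principle;
  homogeneity supplies the factor \<open>r ^ l\<close>.
\<close>

lemma poisson_integral_spherical_harmonic: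
  fixes Y :: "'a::euclidean_space \<Rightarrow> real"
  assumes Y: "spherical_harmonic l Y" and r: "0 < r" "r < 1" and x: "x \<in> sphere 0 1"
  shows "poisson_integral Y (r *\<^sub>R x) = r ^ l * Y x"
proof -
  obtain p where p: "real_polynomial_function p" "\<And>c x. p (c *\<^sub>R x) = c ^ l * p x"
     "\<And>x. laplacian p x = 0" "\<And>x. x \<in> sphere 0 1 \<Longrightarrow> Y x = p x"
    using Y unfolding spherical_harmonic_def by blast
  have cY: "continuous_on (sphere 0 1) Y" by (rule continuous_on_spherical_harmonic[OF Y])
  obtain B where B: "B > 0" "\<And>y. y \<in> sphere 0 1 \<Longrightarrow> \<bar>Y y\<bar> \<le> B"
    using sphere_bound_continuous[OF cY] by blast
  have "\<bar>poisson_integral Y (r *\<^sub>R x) - p (r *\<^sub>R x)\<bar> \<le> 0 + e" if e: "e > 0" for e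
  proof -
    have "((\<lambda>R::real. (1 - R ^ l) * B) \<longlongrightarrow> (1 - 1 ^ l) * B) (at_left 1)"
      by (intro tendsto_intros)
    then have "\<forall>\<^sub>F R::real in at_left 1. (1 - R ^ l) * B < e / 2"
      by (rule order_tendstoD(2)) (use e in simp)
    moreover have "\<forall>\<^sub>F R in at_left 1. R \<in> {r<..<1}"
      by (rule eventually_at_left_real) (use r in simp)
    moreover have "\<forall>\<^sub>F R in at_left 1. \<forall>z\<in>sphere 0 1. \<bar>poisson_integral Y (R *\<^sub>R z) - Y z\<bar> \<le> e / 2"
      by (rule poisson_approximate_identity[OF cY]) (use e in simp)
    ultimately have "\<forall>\<^sub>F R in at_left 1. (1 - R ^ l) * B < e / 2 \<and> R \<in> {r<..<1} \<and>
        (\<forall>z\<in>sphere 0 1. \<bar>poisson_integral Y (R *\<^sub>R z) - Y z\<bar> \<le> e / 2)"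
      by eventually_elim blast
    then have "\<exists>R. (1 - R ^ l) * B < e / 2 \<and> R \<in> {r<..<1} \<and>
        (\<forall>z\<in>sphere 0 1. \<bar>poisson_integral Y (R *\<^sub>R z) - Y z\<bar> \<le> e / 2)"
      by (rule eventually_happens'[OF trivial_limit_at_left_real])
    then obtain R where R: "(1 - R ^ l) * B < e / 2" "r < R" "R < 1"
      "\<And>z. z \<in> sphere 0 1 \<Longrightarrow> \<bar>poisson_integral Y (R *\<^sub>R z) - Y z\<bar> \<le> e / 2"
      by auto
    have "\<bar>poisson_integral Y (r *\<^sub>R x) - p (r *\<^sub>R x)\<bar> \<le> e"
    proof (rule weak_maximum_principle_abs[where R = R and u = "\<lambda>z. poisson_integral Y z - p z"])
      show "continuous_on (cball 0 R) (\<lambda>z. poisson_integral Y z - p z)"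
        using p(1) R
        by (intro continuous_intros continuous_on_poisson_integral cY continuous_on_polymonial_function)
          (auto simp: real_polynomial_function_eq)
      show "r *\<^sub>R x \<in> cball 0 R" using r R x by simp
      fix z :: 'a
      show "weakly_harmonic_at (\<lambda>z. poisson_integral Y z - p z) z" if "z \<in> ball 0 R"
        by (intro weakly_harmonic_at_diff poisson_integral_harmonic weakly_harmonic_at_polynomial cY p)
          (use that R in auto)
      assume z: "z \<in> sphere 0 R"
      define z' where "z' = (1 / R) *\<^sub>R z"
      have z': "z' \<in> sphere 0 1" "z = R *\<^sub>R z'" using z R r by (auto simp: z'_def)
      have "\<bar>Y z' - p z\<bar> = (1 - R ^ l) * \<bar>Y z'\<bar>"
      proof -
        have "Y z' - p z = (1 - R ^ l) * Y z'"
          using p(4)[OF z'(1)] by (simp add: z'(2) p(2) algebra_simps)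
        then show ?thesis using R r by (simp add: abs_mult power_le_one)
      qed
      also have "\<dots> \<le> (1 - R ^ l) * B"
        using R r by (intro mult_left_mono B z') (simp add: power_le_one)
      finally show "\<bar>poisson_integral Y z - p z\<bar> \<le> e"
        using R(1) R(4)[OF z'(1)] unfolding z'(2)[symmetric] by linarith
    qed
    then show ?thesis by simp
  qed
  then have "\<bar>poisson_integral Y (r *\<^sub>R x) - p (r *\<^sub>R x)\<bar> \<le> 0"
    by (rule field_le_epsilon)
  then show ?thesis by (simp add: p(2) p(4)[OF x])
qed

lemma poisson_symmetric:
  fixes x y :: "'a::euclidean_space"
  assumes "x \<in> sphere 0 1" "y \<in> sphere 0 1"
  shows "poisson (r *\<^sub>R x) y = poisson (r *\<^sub>R y) x"
proof -
  have "x \<bullet> x = 1" "y \<bullet> y = 1" using assms by (simp_all add: dot_square_norm)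
  then have "(norm (r *\<^sub>R x - y))\<^sup>2 = (norm (r *\<^sub>R y - x))\<^sup>2"
    unfolding power2_norm_eq_inner inner_diff_left inner_diff_right inner_scaleR_left
      inner_scaleR_right inner_commute[of y x]
    by simp
  then have "norm (r *\<^sub>R x - y) = norm (r *\<^sub>R y - x)"
    by (rule power2_eq_imp_eq) auto
  then show ?thesis using assms by (simp add: poisson_def)
qed

text \<open>
  Fubini and the symmetry of the kernel move the Poisson integral from \<open>f\<close> to \<open>Y\<close>. In terms of Fourier
  coefficients: the Poisson integral multiplies those of degree \<open>l\<close> by \<open>r ^ l\<close>.
\<close>

lemma integral_poisson_integral_mult:
  fixes f Y :: "'a::euclidean_space \<Rightarrow> real"
  assumes f: "continuous_on (sphere 0 1) f" and Y: "spherical_harmonic l Y" and r: "0 < r" "r < 1"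
  shows "(LINT x|sphere_measure. poisson_integral f (r *\<^sub>R x) * Y x)
       = r ^ l * (LINT x|sphere_measure. f x * Y x)"
proof -
  let ?S = "sphere 0 1 :: 'a set" and ?\<sigma> = "sphere_measure :: 'a measure"
  interpret finite_measure ?\<sigma> by (rule finite_measure_sphere_measure)
  interpret P: pair_sigma_finite ?\<sigma> ?\<sigma> ..
  interpret PP: finite_measure "?\<sigma> \<Otimes>\<^sub>M ?\<sigma>"
    by (rule finite_measure_pair_measure[OF finite_measure_sphere_measure finite_measure_sphere_measure])
  have cY: "continuous_on ?S Y" by (rule continuous_on_spherical_harmonic[OF Y])
  \<comment> \<open>A continuous integrand on the compact product is bounded, hence integrable for the product measure.\<close>
  define F where "F v = poisson (r *\<^sub>R fst v) (snd v) * f (snd v) * Y (fst v)" for v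
  have cF: "continuous_on (?S \<times> ?S) F"
    unfolding F_def
    by (intro continuous_intros continuous_on_poisson continuous_on_compose2[OF f] continuous_on_compose2[OF cY])
      (use r in auto)
  have "(\<lambda>x. x) \<in> measurable ?\<sigma> borel"
    by (rule borel_measurable_sphere_continuous[OF continuous_on_id])
  then have "(\<lambda>v. (fst v, snd v)) \<in> measurable (?\<sigma> \<Otimes>\<^sub>M ?\<sigma>) (borel \<Otimes>\<^sub>M borel)"
    by (intro measurable_Pair measurable_compose[OF measurable_fst] measurable_compose[OF measurable_snd])
  then have id: "(\<lambda>v. v) \<in> measurable (?\<sigma> \<Otimes>\<^sub>M ?\<sigma>) borel"
    by (simp add: borel_prod)
  have "(\<lambda>v. indicator (?S \<times> ?S) v *\<^sub>R F v) \<in> borel_measurable borel"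
    using borel_measurable_continuous_on_restrict[OF cF]
    by (subst (asm) borel_measurable_restrict_space_iff) (auto intro!: borel_closed closed_Times)
  from measurable_compose[OF id this]
  have "F \<in> borel_measurable (?\<sigma> \<Otimes>\<^sub>M ?\<sigma>)"
    by (rule measurable_cong[THEN iffD1, rotated]) (auto simp: space_pair_measure)
  moreover obtain B where B: "\<And>v. v \<in> ?S \<times> ?S \<Longrightarrow> \<bar>F v\<bar> \<le> B"
  proof -
    have "compact (F ` (?S \<times> ?S))" by (intro compact_continuous_image cF compact_Times) auto
    then obtain B where "\<forall>y\<in>F ` (?S \<times> ?S). norm y \<le> B"
      using compact_imp_bounded bounded_pos by blast
    then show ?thesis by (intro that[of B]) auto
  qed
  ultimately have int: "integrable (?\<sigma> \<Otimes>\<^sub>M ?\<sigma>) F"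
    by (intro PP.integrable_const_bound[where B = B] AE_I2) (auto simp: space_pair_measure)
  have "(LINT x|?\<sigma>. poisson_integral f (r *\<^sub>R x) * Y x) = (LINT x|?\<sigma>. LINT y|?\<sigma>. F (x, y))"
    by (simp add: poisson_integral_def F_def)
  also have "\<dots> = (LINT y|?\<sigma>. LINT x|?\<sigma>. F (x, y))"
    using P.Fubini_integral[of "\<lambda>x y. F (x, y)"] int by simp
  also have "\<dots> = (LINT y|?\<sigma>. r ^ l * (f y * Y y))"
  proof (rule Bochner_Integration.integral_cong[OF refl])
    fix y assume "y \<in> space ?\<sigma>"
    then have y: "y \<in> ?S" by simp
    have "(LINT x|?\<sigma>. F (x, y)) = (LINT x|?\<sigma>. f y * (poisson (r *\<^sub>R y) x * Y x))"
      by (rule Bochner_Integration.integral_cong) (use poisson_symmetric[OF y] in \<open>auto simp: F_def\<close>)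
    also have "\<dots> = f y * poisson_integral Y (r *\<^sub>R y)"
      by (simp add: poisson_integral_def)
    also have "\<dots> = r ^ l * (f y * Y y)"
      by (simp add: poisson_integral_spherical_harmonic[OF Y r y])
    finally show "(LINT x|?\<sigma>. F (x, y)) = r ^ l * (f y * Y y)" .
  qed
  finally show ?thesis by simp
qed

text \<open>
  The symmetric operator of Poisson integration has distinct eigenvalues on different degrees.
\<close>

lemma spherical_harmonics_orthogonal:
  fixes Y Z :: "'a::euclidean_space \<Rightarrow> real"
  assumes Y: "spherical_harmonic l Y" and Z: "spherical_harmonic m Z" and "l \<noteq> m"
  shows "(LINT x|sphere_measure. Y x * Z x) = 0"
proof -
  let ?I = "LINT x|sphere_measure. Y x * Z x"
  have "(1 / 2) ^ m * ?I = (LINT x|sphere_measure. poisson_integral Y ((1 / 2) *\<^sub>R x) * Z x)"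
    by (rule integral_poisson_integral_mult[OF continuous_on_spherical_harmonic[OF Y] Z, symmetric]) auto
  also have "\<dots> = (LINT x|sphere_measure. (1 / 2) ^ l * (Y x * Z x))"
    by (rule Bochner_Integration.integral_cong)
      (use poisson_integral_spherical_harmonic[OF Y, of "1 / 2"] in auto)
  also have "\<dots> = (1 / 2) ^ l * ?I" by (rule integral_mult_right_zero)
  finally have "((1 / 2) ^ m - (1 / 2 :: real) ^ l) * ?I = 0"
    by (simp add: algebra_simps)
  moreover have "(1 / 2 :: real) ^ m \<noteq> (1 / 2) ^ l"
    using assms(3) by (simp add: power_inject_exp')
  ultimately show ?thesis by simp
qed

section \<open>Comparison of Poisson kernels\<close>

text \<open>
  From \<open>(norm (r *\<^sub>R x - y))\<^sup>2 = (1 - r)\<^sup>2 + r * (norm (x - y))\<^sup>2\<close> the distances for \<open>r\<close> and \<open>r'\<close> have a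
  ratio of at most \<open>q = (1 - r) / (1 - r')\<close>. The denominators contribute \<open>q ^ DIM('a)\<close> and the numerators
  give back one factor \<open>q\<close>, up to the constant \<open>2\<close>.
\<close>

lemma poisson_comparison:
  fixes x y :: "'a::euclidean_space"
  assumes x: "x \<in> sphere 0 1" and y: "y \<in> sphere 0 1" and r: "0 < r" "r \<le> r'" "r' < 1"
  shows "poisson (r' *\<^sub>R x) y \<le> 2 * ((1 - r) / (1 - r')) ^ (DIM('a) - 1) * poisson (r *\<^sub>R x) y"
proof -
  define n where "n = DIM('a)"
  define q where "q = (1 - r) / (1 - r')"
  have q: "q \<ge> 1" using r by (simp add: q_def)
  have nrm: "(norm (s *\<^sub>R x - y))\<^sup>2 = (1 - s)\<^sup>2 + s * (norm (x - y))\<^sup>2" for s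
  proof -
    have "x \<bullet> x = 1" "y \<bullet> y = 1" using x y by (simp_all add: dot_square_norm)
    then show ?thesis
      unfolding power2_norm_eq_inner inner_diff_left inner_diff_right inner_scaleR_left
        inner_scaleR_right inner_commute[of y x]
      by (simp add: power2_eq_square algebra_simps)
  qed
  have pos: "norm (s *\<^sub>R x - y) > 0" if "0 < s" "s < 1" for s
  proof -
    have "s *\<^sub>R x \<in> ball 0 1" using x that by simp
    from ball_neq_sphere[OF this y] show ?thesis by simp
  qed
  have "(norm (r *\<^sub>R x - y))\<^sup>2 \<le> (q * norm (r' *\<^sub>R x - y))\<^sup>2"
  proof -
    have "r * (norm (x - y))\<^sup>2 \<le> q\<^sup>2 * (r' * (norm (x - y))\<^sup>2)"
      using mult_mono[of 1 "q\<^sup>2" "r * (norm (x - y))\<^sup>2" "r' * (norm (x - y))\<^sup>2"] q r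
      by (simp add: mult_right_mono)
    moreover have "(1 - r)\<^sup>2 = q\<^sup>2 * (1 - r')\<^sup>2"
      using r by (simp add: q_def power_divide)
    ultimately show ?thesis unfolding power_mult_distrib nrm distrib_left by simp
  qed
  then have le: "norm (r *\<^sub>R x - y) \<le> q * norm (r' *\<^sub>R x - y)"
    by (rule power2_le_imp_le) (use q in simp)
  have "1 / a \<le> q / b" if "b \<le> q * a" "0 < a" "0 < b" for a b :: real
    using that by (simp add: field_simps)
  then have "1 / norm (r' *\<^sub>R x - y) \<le> q / norm (r *\<^sub>R x - y)"
    using le pos[of r] pos[of r'] r by (meson order.strict_trans1 order.strict_trans2)
  then have 1: "(1 / norm (r' *\<^sub>R x - y)) ^ n \<le> (q / norm (r *\<^sub>R x - y)) ^ n"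
    by (rule power_mono) simp
  have 2: "1 - r'\<^sup>2 \<le> 2 * (1 - r\<^sup>2) / q"
  proof -
    have "(1 - r'\<^sup>2) * q = (1 + r') * (1 - r)"
      using r by (simp add: q_def power2_eq_square field_simps)
    also have "\<dots> \<le> (2 * (1 + r)) * (1 - r)"
      using r by (intro mult_right_mono) auto
    finally show ?thesis using q by (simp add: field_simps power2_eq_square)
  qed
  have "poisson (r' *\<^sub>R x) y = (1 - r'\<^sup>2) * (1 / norm (r' *\<^sub>R x - y)) ^ n"
    using x by (simp add: poisson_def n_def power_divide)
  also have "\<dots> \<le> (2 * (1 - r\<^sup>2) / q) * (q / norm (r *\<^sub>R x - y)) ^ n"
    using 1 2 r pos[of r'] q by (intro mult_mono) (auto simp: power_le_one)
  also have "\<dots> = 2 * q ^ (n - 1) * ((1 - r\<^sup>2) / norm (r *\<^sub>R x - y) ^ n)"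
  proof -
    have "q ^ n = q * q ^ (n - 1)"
      using DIM_positive[where 'a='a] by (simp add: n_def power_eq_if)
    then show ?thesis using q by (simp add: power_divide)
  qed
  also have "(1 - r\<^sup>2) / norm (r *\<^sub>R x - y) ^ n = poisson (r *\<^sub>R x) y"
    using x by (simp add: poisson_def n_def)
  finally show ?thesis by (simp add: n_def q_def)
qed

section \<open>Dyadic summation of the eigenvalue weights\<close>

lemma eigenval_bounds:
  assumes "d \<ge> 1"
  shows "(1 + real l)\<^sup>2 / 2 \<le> 1 + eigenval d l" "1 + eigenval d l \<le> real d * (1 + real l)\<^sup>2"
    "1 \<le> 1 + eigenval d l"
proof -
  have d: "real d \<ge> 1" using assms by simp
  have "0 \<le> real l * (real d - 1)" using d by simp
  moreover have "0 \<le> (real l - 1)\<^sup>2" by simp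
  moreover have "1 + eigenval d l - (1 + real l)\<^sup>2 / 2 = real l * (real d - 1) + (real l - 1)\<^sup>2 / 2"
    by (simp add: eigenval_def power2_eq_square field_simps)
  ultimately show "(1 + real l)\<^sup>2 / 2 \<le> 1 + eigenval d l"
    by linarith
  show "1 \<le> 1 + eigenval d l"
    using d by (simp add: eigenval_def)
  have "0 \<le> (real d - 1) * (real l * real l + real l + 1)"
    using d by simp
  moreover have "0 \<le> real l" by simp
  ultimately show "1 + eigenval d l \<le> real d * (1 + real l)\<^sup>2"
    using d by (simp add: eigenval_def power2_eq_square algebra_simps)
qed

text \<open>
  With \<open>h = 1 - r\<close> one has \<open>r ^ l \<le> exp (- (l * h))\<close> and \<open>(1 + l) * h \<le> 1 + l * h\<close>, and the
  exponential absorbs any power of \<open>1 + l * h\<close>.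
\<close>

lemma eigenval_powr_geometric_bounded:
  assumes "d \<ge> 1" "s \<ge> 0"
  obtains C where "C > 0" "\<And>r l. 0 < r \<Longrightarrow> r < 1 \<Longrightarrow>
    (1 + eigenval d l) powr s * r ^ l \<le> C * (1 - r) powr (- 2 * s)"
proof -
  define m where "m = nat \<lceil>2 * s\<rceil>"
  have m: "2 * s \<le> real m" unfolding m_def using assms by linarith
  define C where "C = real d powr s * (fact m * exp 1)"
  have bound: "(1 + eigenval d l) powr s * r ^ l \<le> C * (1 - r) powr (- 2 * s)"
    if r: "0 < r" "r < 1" for r l
  proof -
    define h where "h = 1 - r"
    have h: "0 < h" "h < 1" using r by (auto simp: h_def)
    have w: "(1 + eigenval d l) powr s \<le> real d powr s * (1 + real l) powr (2 * s)"
    proof -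
      have "(1 + eigenval d l) powr s \<le> (real d * (1 + real l)\<^sup>2) powr s"
        using eigenval_bounds[OF assms(1), of l] assms(2) by (intro powr_mono2) auto
      also have "\<dots> = real d powr s * ((1 + real l) powr 2) powr s"
        by (simp add: powr_mult)
      also have "\<dots> = real d powr s * (1 + real l) powr (2 * s)"
        unfolding powr_powr ..
      finally show ?thesis .
    qed
    have "(1 + real l) powr (2 * s) * h powr (2 * s) = ((1 + real l) * h) powr (2 * s)"
      using h by (simp add: powr_mult)
    also have "\<dots> \<le> (1 + real l * h) powr (2 * s)"
      using h assms(2) by (intro powr_mono2) (auto simp: algebra_simps)
    also have "\<dots> \<le> (1 + real l * h) powr (real m)"
      using h m by (intro powr_mono) auto
    also have "\<dots> = (1 + real l * h) ^ m"
      using h by (intro powr_realpow) (simp add: add_pos_nonneg)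
    also have "\<dots> \<le> fact m * exp (1 + real l * h)"
    proof -
      have "(1 + real l * h) ^ m / fact m \<le> (\<Sum>n. (1 + real l * h) ^ n /\<^sub>R fact n)"
        using sum_le_suminf[OF summable_exp_generic, of "{m}" "1 + real l * h"] h
        by (simp add: divide_inverse mult.commute)
      then show ?thesis by (simp add: exp_def field_simps)
    qed
    finally have p: "(1 + real l) powr (2 * s) * h powr (2 * s) \<le> fact m * exp (1 + real l * h)" .
    have "r \<le> exp (- h)" using exp_ge_add_one_self[of "- h"] by (simp add: h_def)
    then have "r ^ l \<le> exp (- h) ^ l" using r by (intro power_mono) auto
    also have "\<dots> = exp (- (real l * h))" by (simp flip: exp_of_nat_mult)
    finally have rl: "r ^ l \<le> exp (- (real l * h))" .
    have "(1 + real l) powr (2 * s) * h powr (2 * s) * r ^ l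
        \<le> (fact m * exp (1 + real l * h)) * exp (- (real l * h))"
      by (intro mult_mono p rl) (use r in auto)
    also have "\<dots> = fact m * exp 1" by (simp flip: exp_add)
    finally have q: "(1 + real l) powr (2 * s) * h powr (2 * s) * r ^ l \<le> fact m * exp 1" .
    have hh: "h powr (2 * s) * h powr (- 2 * s) = 1" using h by (simp flip: powr_add)
    have "(1 + eigenval d l) powr s * r ^ l \<le> real d powr s * (1 + real l) powr (2 * s) * r ^ l"
      using w r by (intro mult_right_mono) auto
    also have "\<dots> = real d powr s * ((1 + real l) powr (2 * s) * h powr (2 * s) * r ^ l) * h powr (- 2 * s)"
      using hh by (simp add: mult_ac)
    also have "\<dots> \<le> real d powr s * (fact m * exp 1) * h powr (- 2 * s)"
      by (intro mult_right_mono mult_left_mono q) auto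
    finally show ?thesis by (simp add: C_def h_def)
  qed
  have "C > 0" using assms by (simp add: C_def)
  with bound that show ?thesis by blast
qed

text \<open>
  From \<open>1 - q \<ge> exp (- 2 * q)\<close>, valid for \<open>q \<le> 1 / 2\<close>.
\<close>

lemma power_one_minus_lower_bound:
  assumes "0 \<le> q" "q \<le> 1 / 2" "real l * q \<le> 2"
  shows "exp (- 4) \<le> (1 - q :: real) ^ l"
proof -
  have "- 2 * q \<le> ln (1 - q)"
  proof -
    have "q * q \<le> q * (1 / 2)" using assms by (intro mult_left_mono) auto
    then show ?thesis
      using ln_one_minus_pos_lower_bound[of q] assms by (simp add: power2_eq_square)
  qed
  then have "exp (- 2 * q) \<le> 1 - q"
    using assms by (subst (asm) ln_ge_iff) auto
  then have "exp (- 2 * q) ^ l \<le> (1 - q) ^ l" by (intro power_mono) auto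
  moreover have "exp (- 2 * q) ^ l = exp (- 2 * (real l * q))"
    by (simp flip: exp_of_nat_mult)
  moreover have "exp (- 4) \<le> exp (- 2 * (real l * q))" using assms by (simp add: mult.commute)
  ultimately show ?thesis by linarith
qed

text \<open>
  If \<open>(1 + l) * h < 1\<close> the first summand suffices. Otherwise
  \<open>2 ^ j \<le> (1 + l) * h \<le> 2 * 2 ^ j\<close> for some \<open>j\<close>; for this \<open>j\<close> the factor \<open>(1 - h / 2 ^ j) ^ l\<close> is at
  least \<open>exp (- 4)\<close>, and the \<open>j\<close>-th summand alone suffices.
\<close>

lemma dyadic_weight_bound:
  assumes d: "d \<ge> 1" and s': "0 \<le> s'" "s' \<le> s" and h: "0 < h" "h \<le> 1 / 2" and l: "l < M"
  shows "(1 + eigenval d l) powr (- s')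
      \<le> real d powr (s - s') * h powr (- 2 * (s - s')) * (1 + eigenval d l) powr (- s)
        + 2 powr s' * exp 4 * (\<Sum>j<M. (2 ^ j / h) powr (- 2 * s') * (1 - h / 2 ^ j) ^ l)"
proof -
  define w where "w = 1 + eigenval d l"
  define x where "x = 1 + real l"
  have w: "x\<^sup>2 / 2 \<le> w" "w \<le> real d * x\<^sup>2" "1 \<le> w" and x: "x \<ge> 1"
    using eigenval_bounds[OF d, of l] by (auto simp: w_def x_def)
  have q: "0 \<le> 1 - h / 2 ^ j" for j
  proof -
    have "h / 2 ^ j \<le> h / 1" using h by (intro divide_left_mono) auto
    then show ?thesis using h by linarith
  qed
  have sum0: "0 \<le> (\<Sum>j<M. (2 ^ j / h) powr (- 2 * s') * (1 - h / 2 ^ j) ^ l)"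
    using q by (intro sum_nonneg mult_nonneg_nonneg zero_le_power) auto
  show ?thesis
  proof (cases "x * h < 1")
    case True
    have "w powr (- s') = w powr (s - s') * w powr (- s)"
      using w by (simp flip: powr_add)
    also have "w powr (s - s') \<le> real d powr (s - s') * h powr (- 2 * (s - s'))"
    proof -
      have "x \<le> 1 / h" using True h by (simp add: field_simps)
      then have "real d * x\<^sup>2 \<le> real d * (1 / h)\<^sup>2"
        using x by (intro mult_left_mono power_mono) auto
      then have "w \<le> real d * (1 / h)\<^sup>2" using w(2) by linarith
      then have "w powr (s - s') \<le> (real d * (1 / h)\<^sup>2) powr (s - s')"
        using w s' by (intro powr_mono2) auto
      also have "(1 / h)\<^sup>2 = h powr (- 2)"
        unfolding powr_minus_divide using h by (simp add: power_divide)
      also have "(real d * h powr (- 2)) powr (s - s') = real d powr (s - s') * h powr (- 2 * (s - s'))"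
        by (simp add: powr_mult powr_powr)
      finally show ?thesis .
    qed
    finally have "w powr (- s') \<le> real d powr (s - s') * h powr (- 2 * (s - s')) * w powr (- s)"
      by (simp add: mult_right_mono)
    moreover have "0 \<le> 2 powr s' * exp 4 * (\<Sum>j<M. (2 ^ j / h) powr (- 2 * s') * (1 - h / 2 ^ j) ^ l)"
      by (intro mult_nonneg_nonneg sum0) auto
    ultimately show ?thesis by (simp add: w_def)
  next
    case False
    then have "1 \<le> \<lfloor>x * h\<rfloor>" by simp
    from nat_mono[OF this] have "1 \<le> nat \<lfloor>x * h\<rfloor>" by simp
    from ex_power_ivl1[of 2, OF _ this] obtain j where
      j: "2 ^ j \<le> nat \<lfloor>x * h\<rfloor>" "nat \<lfloor>x * h\<rfloor> < 2 ^ (j + 1)"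
      by auto
    have jl: "2 ^ j \<le> x * h"
    proof -
      have "real (2 ^ j) \<le> real (nat \<lfloor>x * h\<rfloor>)" using j(1) by (simp only: of_nat_le_iff)
      also have "\<dots> \<le> x * h" using x h by simp
      finally show ?thesis by simp
    qed
    have ju: "x * h \<le> 2 * 2 ^ j"
    proof -
      have "x * h \<le> real (nat \<lfloor>x * h\<rfloor> + 1)" using x h by (simp add: nat_add_distrib) linarith
      also have "\<dots> \<le> real (2 ^ (j + 1))" using j(2) by (simp only: of_nat_le_iff)
      finally show ?thesis by simp
    qed
    have jM: "j < M"
    proof -
      have "real (2 ^ j) \<le> x * h" using jl by simp
      also have "\<dots> \<le> x * 1" using x h by (intro mult_left_mono) auto
      also have "\<dots> = real (Suc l)" by (simp add: x_def)
      finally have "2 ^ j \<le> Suc l" by (simp only: of_nat_le_iff)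
      then show ?thesis using l less_exp[of j] by linarith
    qed
    have pow: "exp (- 4) \<le> (1 - h / 2 ^ j) ^ l"
    proof (rule power_one_minus_lower_bound)
      show "0 \<le> h / 2 ^ j" using h by simp
      have "h / 2 ^ j \<le> h / 1" using h by (intro divide_left_mono) auto
      then show "h / 2 ^ j \<le> 1 / 2" using h by linarith
      have "real l * h \<le> x * h" using h by (simp add: x_def)
      then have "real l * h \<le> 2 * 2 ^ j" using ju by simp
      then show "real l * (h / 2 ^ j) \<le> 2" by (simp add: field_simps)
    qed
    have "w powr (- s') \<le> ((2 ^ j / h)\<^sup>2 / 2) powr (- s')"
    proof (rule powr_mono2')
      have "2 ^ j / h \<le> x" using jl h by (simp add: field_simps)
      then have "(2 ^ j / h)\<^sup>2 / 2 \<le> x\<^sup>2 / 2" using h by (simp add: power_mono)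
      then show "(2 ^ j / h)\<^sup>2 / 2 \<le> w" using w(1) by linarith
    qed (use h s' in auto)
    also have "\<dots> = 2 powr s' * (2 ^ j / h) powr (- 2 * s')"
    proof -
      define y where "y = 2 ^ j / h"
      have "y > 0" using h by (simp add: y_def)
      then have "(y\<^sup>2 / 2) powr (- s') = (y powr 2) powr (- s') / 2 powr (- s')"
        by (simp add: powr_divide)
      also have "\<dots> = y powr (- 2 * s') * 2 powr s'"
        unfolding powr_powr by (simp add: powr_minus_divide)
      finally show ?thesis by (simp add: y_def mult.commute)
    qed
    also have "\<dots> = 2 powr s' * exp 4 * ((2 ^ j / h) powr (- 2 * s') * exp (- 4))"
      by (simp add: mult_ac flip: exp_add)
    also have "\<dots> \<le> 2 powr s' * exp 4 * ((2 ^ j / h) powr (- 2 * s') * (1 - h / 2 ^ j) ^ l)"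
      by (intro mult_left_mono pow) auto
    also have "\<dots> \<le> 2 powr s' * exp 4 * (\<Sum>j<M. (2 ^ j / h) powr (- 2 * s') * (1 - h / 2 ^ j) ^ l)"
      by (intro mult_left_mono member_le_sum) (use jM q in auto)
    finally have "w powr (- s') \<le> 2 powr s' * exp 4 * (\<Sum>j<M. (2 ^ j / h) powr (- 2 * s') * (1 - h / 2 ^ j) ^ l)" .
    moreover have "0 \<le> real d powr (s - s') * h powr (- 2 * (s - s')) * w powr (- s)" by simp
    ultimately show ?thesis unfolding w_def by linarith
  qed
qed

text \<open>
  After summation against \<open>D\<close>, the \<open>j\<close>-th dyadic scale contributes
  \<open>(2 ^ j / h) powr (- 2 * s') * 2 ^ (j * d)\<close> up to a constant. This is a convergent geometric series exactly
  because \<open>2 * s' > d\<close>.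
\<close>

lemma dyadic_energy_bound:
  assumes d: "d \<ge> 1" and s': "real d / 2 < s'" "s' \<le> s" and A: "0 \<le> A" and B: "0 \<le> B"
  shows "\<exists>C>0. \<forall>h (D :: nat \<Rightarrow> real) M. 0 < h \<longrightarrow> h \<le> 1 / 2 \<longrightarrow> (\<forall>l. 0 \<le> D l) \<longrightarrow>
       (\<forall>M. (\<Sum>l<M. (1 + eigenval d l) powr (- s) * D l) \<le> A * h powr (2 * s)) \<longrightarrow>
       (\<forall>j M. (\<Sum>l<M. (1 - h / 2 ^ j) ^ l * D l) \<le> B * 2 ^ (j * d)) \<longrightarrow>
       (\<Sum>l<M. (1 + eigenval d l) powr (- s') * D l) \<le> C * h powr (2 * s')"
proof -
  \<comment> \<open>The ratio of the geometric series over the scales.\<close>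
  define \<rho> where "\<rho> = 2 powr (real d - 2 * s')"
  have \<rho>: "0 < \<rho>" "\<rho> < 1"
    using s' by (auto simp: \<rho>_def intro!: powr_less_one)
  define C where "C = real d powr (s - s') * A + 2 powr s' * exp 4 * (B / (1 - \<rho>)) + 1"
  have "C > 0" using A B \<rho> by (auto simp: C_def intro!: add_nonneg_pos add_nonneg_nonneg)
  moreover have bound: "(\<Sum>l<M. (1 + eigenval d l) powr (- s') * D l) \<le> C * h powr (2 * s')"
    if h: "0 < h" "h \<le> 1 / 2" and D: "\<And>l. 0 \<le> D l"
      and low: "\<And>M. (\<Sum>l<M. (1 + eigenval d l) powr (- s) * D l) \<le> A * h powr (2 * s)"
      and high: "\<And>j M. (\<Sum>l<M. (1 - h / 2 ^ j) ^ l * D l) \<le> B * 2 ^ (j * d)"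
    for h M and D :: "nat \<Rightarrow> real"
  proof -
    let ?a = "real d powr (s - s') * h powr (- 2 * (s - s'))" and ?b = "2 powr s' * exp (4::real)"
    have s0: "0 \<le> s'" using s' d by (smt (verit) divide_nonneg_nonneg of_nat_0_le_iff)
    have "(\<Sum>l<M. (1 + eigenval d l) powr (- s') * D l)
        \<le> (\<Sum>l<M. ?a * ((1 + eigenval d l) powr (- s) * D l)
            + ?b * (\<Sum>j<M. (2 ^ j / h) powr (- 2 * s') * ((1 - h / 2 ^ j) ^ l * D l)))"
    proof (rule sum_mono)
      fix l assume "l \<in> {..<M}"
      then have "(1 + eigenval d l) powr (- s') * D l \<le> (?a * (1 + eigenval d l) powr (- s)
          + ?b * (\<Sum>j<M. (2 ^ j / h) powr (- 2 * s') * (1 - h / 2 ^ j) ^ l)) * D l"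
        by (intro mult_right_mono dyadic_weight_bound d s0 s' h D) auto
      then show "(1 + eigenval d l) powr (- s') * D l \<le> ?a * ((1 + eigenval d l) powr (- s) * D l)
            + ?b * (\<Sum>j<M. (2 ^ j / h) powr (- 2 * s') * ((1 - h / 2 ^ j) ^ l * D l))"
        by (simp only: distrib_right sum_distrib_right mult.assoc)
    qed
    also have "\<dots> = ?a * (\<Sum>l<M. (1 + eigenval d l) powr (- s) * D l)
        + ?b * (\<Sum>l<M. \<Sum>j<M. (2 ^ j / h) powr (- 2 * s') * ((1 - h / 2 ^ j) ^ l * D l))"
      by (simp only: sum.distrib sum_distrib_left)
    also have "(\<Sum>l<M. \<Sum>j<M. (2 ^ j / h) powr (- 2 * s') * ((1 - h / 2 ^ j) ^ l * D l))
        = (\<Sum>j<M. (2 ^ j / h) powr (- 2 * s') * (\<Sum>l<M. (1 - h / 2 ^ j) ^ l * D l))"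
      by (subst sum.swap) (simp only: sum_distrib_left)
    also have "\<dots> \<le> (\<Sum>j<M. (2 ^ j / h) powr (- 2 * s') * (B * 2 ^ (j * d)))"
      by (intro sum_mono mult_left_mono high) auto
    also have "\<dots> = (\<Sum>j<M. (h powr (2 * s') * B) * \<rho> ^ j)"
    proof (rule sum.cong[OF refl])
      fix j
      have "h powr (- 2 * s') * h powr (2 * s') = 1"
        using h by (simp flip: powr_add)
      then have inv: "1 / h powr (- 2 * s') = h powr (2 * s')"
        using h by (simp add: divide_eq_eq mult.commute)
      have pj: "(2::real) ^ n = 2 powr real n" for n by (simp add: powr_realpow)
      have "(2 ^ j / h) powr (- 2 * s') = (2 ^ j) powr (- 2 * s') * (1 / h powr (- 2 * s'))"
        using h by (simp add: powr_divide)
      also have "\<dots> = h powr (2 * s') * (2 powr real j) powr (- 2 * s')"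
        unfolding inv pj by (rule mult.commute)
      finally have "(2 ^ j / h) powr (- 2 * s') = h powr (2 * s') * (2 powr real j) powr (- 2 * s')" .
      moreover have "(2 powr real j) powr (- 2 * s') * 2 ^ (j * d) = \<rho> ^ j"
      proof -
        have "\<rho> ^ j = \<rho> powr real j" using \<rho> by (simp add: powr_realpow)
        also have "\<dots> = 2 powr (real j * (- 2 * s') + real (j * d))"
          unfolding \<rho>_def powr_powr by (simp add: algebra_simps)
        also have "\<dots> = (2 powr real j) powr (- 2 * s') * 2 ^ (j * d)"
          unfolding pj powr_powr by (rule powr_add)
        finally show ?thesis ..
      qed
      ultimately show "(2 ^ j / h) powr (- 2 * s') * (B * 2 ^ (j * d)) = (h powr (2 * s') * B) * \<rho> ^ j"
        by (simp add: mult_ac)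
    qed
    also have "\<dots> \<le> (h powr (2 * s') * B) * (1 / (1 - \<rho>))"
    proof -
      have "(\<Sum>j<M. \<rho> ^ j) \<le> 1 / (1 - \<rho>)"
        using \<rho> by (subst suminf_geometric[symmetric]) (auto intro!: sum_le_suminf summable_geometric)
      then show ?thesis
        unfolding sum_distrib_left[symmetric] using B by (intro mult_left_mono) auto
    qed
    finally have "(\<Sum>l<M. (1 + eigenval d l) powr (- s') * D l)
        \<le> ?a * (\<Sum>l<M. (1 + eigenval d l) powr (- s) * D l) + ?b * ((h powr (2 * s') * B) * (1 / (1 - \<rho>)))"
      by (simp add: mult_left_mono)
    also have "?a * (\<Sum>l<M. (1 + eigenval d l) powr (- s) * D l) \<le> ?a * (A * h powr (2 * s))"
      by (intro mult_left_mono low) auto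
    also have "?a * (A * h powr (2 * s)) = real d powr (s - s') * A * h powr (2 * s')"
    proof -
      have "h powr (- 2 * (s - s')) * h powr (2 * s) = h powr (2 * s')"
        using h by (simp flip: powr_add add: algebra_simps)
      then show ?thesis by (metis mult.assoc mult.left_commute)
    qed
    finally have "(\<Sum>l<M. (1 + eigenval d l) powr (- s') * D l)
        \<le> real d powr (s - s') * A * h powr (2 * s') + ?b * ((h powr (2 * s') * B) * (1 / (1 - \<rho>)))"
      by simp
    also have "\<dots> = (C - 1) * h powr (2 * s')"
      by (simp add: C_def algebra_simps)
    also have "\<dots> \<le> C * h powr (2 * s')" by (intro mult_right_mono) auto
    finally show ?thesis .
  qed
  ultimately show ?thesis
    by (intro exI[of _ C] conjI allI impI) (assumption, rule bound, blast+)
qed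

section \<open>The quadrature error as a functional\<close>

lemma abs_sum_mset_le:
  fixes f :: "'a \<Rightarrow> real"
  assumes "\<And>x. x \<in># P \<Longrightarrow> \<bar>f x\<bar> \<le> e"
  shows "\<bar>\<Sum>x\<in>#P. f x\<bar> \<le> real (size P) * e"
  using assms
proof (induction P)
  case (add x P)
  then have "\<bar>f x\<bar> \<le> e" "\<bar>\<Sum>x\<in>#P. f x\<bar> \<le> real (size P) * e" by auto
  then show ?case by (simp add: algebra_simps)
qed simp

lemma integral_sum_mset:
  fixes F :: "'b \<Rightarrow> 'a \<Rightarrow> real"
  assumes "\<And>x. x \<in># P \<Longrightarrow> integrable M (F x)"
  shows "integrable M (\<lambda>y. \<Sum>x\<in>#P. F x y)"
    and "(LINT y|M. (\<Sum>x\<in>#P. F x y)) = (\<Sum>x\<in>#P. (LINT y|M. F x y))"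
proof -
  have "integrable M (\<lambda>y. \<Sum>x\<in>#P. F x y) \<and> (LINT y|M. (\<Sum>x\<in>#P. F x y)) = (\<Sum>x\<in>#P. (LINT y|M. F x y))"
    using assms by (induction P) auto
  then show "integrable M (\<lambda>y. \<Sum>x\<in>#P. F x y)"
    "(LINT y|M. (\<Sum>x\<in>#P. F x y)) = (\<Sum>x\<in>#P. (LINT y|M. F x y))" by auto
qed

lemma continuous_on_sum_mset:
  fixes F :: "'b \<Rightarrow> 'a::topological_space \<Rightarrow> real"
  assumes "\<And>x. x \<in># P \<Longrightarrow> continuous_on S (F x)"
  shows "continuous_on S (\<lambda>y. \<Sum>x\<in>#P. F x y)"
  using assms by (induction P) (auto intro!: continuous_intros)

lemma continuous_in_sphere_L2:
  assumes "continuous_on (sphere 0 1) f"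
  shows "f \<in> sphere_L2"
  unfolding sphere_L2_def
  using assms by (auto intro!: borel_measurable_sphere_continuous integrable_sphere_continuous continuous_intros)

definition quadrature_error :: "'a::euclidean_space multiset \<Rightarrow> ('a \<Rightarrow> real) \<Rightarrow> real" where
  "quadrature_error P f = 1 / real (size P) * (\<Sum>x\<in>#P. f x) - (LINT x|sphere_measure. f x)"

lemma quadrature_error_cmult:
  "quadrature_error P (\<lambda>x. c * f x) = c * quadrature_error P f"
  by (simp add: quadrature_error_def right_diff_distrib sum_mset_distrib_left[symmetric])

lemma quadrature_error_add:
  assumes "continuous_on (sphere 0 1) f" "continuous_on (sphere 0 1) g"
  shows "quadrature_error P (\<lambda>x. f x + g x) = quadrature_error P f + quadrature_error P g"
  using assms
  by (simp add: quadrature_error_def sum_mset.distrib integrable_sphere_continuous add_divide_distrib)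

lemma quadrature_error_diff:
  assumes "continuous_on (sphere 0 1) f" "continuous_on (sphere 0 1) g"
  shows "quadrature_error P (\<lambda>x. f x - g x) = quadrature_error P f - quadrature_error P g"
  using quadrature_error_add[OF assms(1), of "\<lambda>x. - 1 * g x"] quadrature_error_cmult[of P "- 1" g] assms(2)
  by (simp add: continuous_on_minus)

lemma quadrature_error_sum:
  assumes "finite A" "\<And>i. i \<in> A \<Longrightarrow> continuous_on (sphere 0 1) (f i)"
  shows "quadrature_error P (\<lambda>x. \<Sum>i\<in>A. f i x) = (\<Sum>i\<in>A. quadrature_error P (f i))"
  using assms
proof (induction A)
  case empty
  then show ?case by (simp add: quadrature_error_def)
next
  case (insert i A)
  have "continuous_on (sphere 0 1) (\<lambda>x. \<Sum>i\<in>A. f i x)"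
    using insert by (intro continuous_intros) auto
  then show ?case
    using insert by (simp add: quadrature_error_add)
qed

section \<open>Expansion in an orthonormal family of harmonics\<close>

locale harmonic_basis =
  fixes d :: nat and Y :: "nat \<Rightarrow> nat \<Rightarrow> 'a::euclidean_space \<Rightarrow> real"
  assumes orthonormal: "orthonormal_harmonics d Y"
begin

abbreviation "K l \<equiv> {1..harm_dim d l}"

lemma harmonic: "k \<in> K l \<Longrightarrow> spherical_harmonic l (Y l k)"
  using orthonormal unfolding orthonormal_harmonics_def by blast

lemma continuous_harmonic [continuous_intros]: "k \<in> K l \<Longrightarrow> continuous_on (sphere 0 1) (Y l k)"
  by (rule continuous_on_spherical_harmonic[OF harmonic])

lemma integral_harmonic_mult:
  assumes "j \<in> K l" "k \<in> K m"
  shows "(LINT x|sphere_measure. Y l j x * Y m k x) = (if l = m \<and> j = k then 1 else 0)"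
proof (cases "l = m")
  case True
  then show ?thesis using assms orthonormal unfolding orthonormal_harmonics_def by auto
next
  case False
  then show ?thesis using spherical_harmonics_orthogonal[OF harmonic harmonic] assms by auto
qed

lemma integral_harmonic:
  assumes "k \<in> K l" "l \<noteq> 0"
  shows "(LINT x|sphere_measure. Y l k x) = 0"
  using spherical_harmonics_orthogonal[OF harmonic[OF assms(1)] spherical_harmonic_const[of 1] assms(2)]
  by simp

lemma fourier_coeff_diff:
  assumes "continuous_on (sphere 0 1) f" "continuous_on (sphere 0 1) g" "k \<in> K l"
  shows "fourier_coeff Y (\<lambda>x. f x - g x) l k = fourier_coeff Y f l k - fourier_coeff Y g l k"
  unfolding fourier_coeff_def left_diff_distrib
  by (intro Bochner_Integration.integral_diff integrable_sphere_continuous continuous_intros assms)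

lemma fourier_coeff_cmult: "fourier_coeff Y (\<lambda>x. c * f x) l k = c * fourier_coeff Y f l k"
  by (simp add: fourier_coeff_def mult.assoc)

definition expansion :: "nat \<Rightarrow> (nat \<Rightarrow> nat \<Rightarrow> real) \<Rightarrow> 'a \<Rightarrow> real" where
  "expansion M c x = (\<Sum>l<M. \<Sum>k\<in>K l. c l k * Y l k x)"

lemma continuous_expansion: "continuous_on (sphere 0 1) (expansion M c)"
  unfolding expansion_def[abs_def] by (intro continuous_intros)

lemma fourier_coeff_expansion:
  assumes k: "k \<in> K l"
  shows "fourier_coeff Y (expansion M c) l k = (if l < M then c l k else 0)"
proof -
  have int: "integrable sphere_measure (\<lambda>x. c m j * (Y m j x * Y l k x))" if "j \<in> K m" for m j
    by (intro integrable_sphere_continuous continuous_intros that k)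
  have "fourier_coeff Y (expansion M c) l k
      = (LINT x|sphere_measure. (\<Sum>m<M. \<Sum>j\<in>K m. c m j * (Y m j x * Y l k x)))"
    by (simp add: fourier_coeff_def expansion_def sum_distrib_right mult.assoc)
  also have "\<dots> = (\<Sum>m<M. (LINT x|sphere_measure. (\<Sum>j\<in>K m. c m j * (Y m j x * Y l k x))))"
    by (intro Bochner_Integration.integral_sum Bochner_Integration.integrable_sum int)
  also have "\<dots> = (\<Sum>m<M. \<Sum>j\<in>K m. (LINT x|sphere_measure. c m j * (Y m j x * Y l k x)))"
    by (intro sum.cong refl Bochner_Integration.integral_sum int)
  also have "\<dots> = (\<Sum>m<M. \<Sum>j\<in>K m. if m = l then (if j = k then c m j else 0) else 0)"
    by (intro sum.cong refl) (simp add: integral_harmonic_mult[OF _ k])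
  also have "\<dots> = (\<Sum>m<M. if m = l then c l k else 0)"
    using k by (intro sum.cong refl) (auto simp: sum.delta')
  also have "\<dots> = (if l < M then c l k else 0)" by (simp add: sum.delta')
  finally show ?thesis .
qed

lemma quadrature_error_expansion:
  "quadrature_error P (expansion M c) = (\<Sum>l<M. \<Sum>k\<in>K l. c l k * quadrature_error P (Y l k))"
proof -
  have "quadrature_error P (expansion M c) = (\<Sum>l<M. quadrature_error P (\<lambda>x. \<Sum>k\<in>K l. c l k * Y l k x))"
    unfolding expansion_def[abs_def] by (rule quadrature_error_sum) (auto intro!: continuous_intros)
  also have "\<dots> = (\<Sum>l<M. \<Sum>k\<in>K l. quadrature_error P (\<lambda>x. c l k * Y l k x))"
    by (intro sum.cong refl quadrature_error_sum) (auto intro!: continuous_intros)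
  finally show ?thesis by (simp only: quadrature_error_cmult)
qed

end

section \<open>Duality between the worst-case error and the defects\<close>

locale quadrature = harmonic_basis d Y
  for d :: nat and Y :: "nat \<Rightarrow> nat \<Rightarrow> 'a::euclidean_space \<Rightarrow> real" +
  fixes s :: real and a :: "nat \<Rightarrow> real" and c2 :: real and P :: "'a multiset" and \<epsilon> :: real
  assumes d: "d \<ge> 1" and s: "s \<ge> 0"
    and weight_pos: "\<And>l. a l > 0" and c2: "c2 > 0"
    and weight_lower: "\<And>l. (1 + eigenval d l) powr (- s) \<le> c2 * a l"
    and nonempty: "P \<noteq> {#}" and on_sphere: "set_mset P \<subseteq> sphere 0 1"
    and worst_case: "worst_case_error d Y a s P \<le> ereal \<epsilon>"
begin

abbreviation "err \<equiv> quadrature_error P"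
abbreviation "w l \<equiv> 1 + eigenval d l"

definition defect :: "nat \<Rightarrow> real" where
  "defect l = (\<Sum>k\<in>K l. (err (Y l k))\<^sup>2)"

lemma defect_nonneg: "0 \<le> defect l"
  by (simp add: defect_def sum_nonneg)

lemma w_ge_1: "1 \<le> w l"
  by (rule eigenval_bounds(3)[OF d])

lemma weight_inverse_le: "1 / a l \<le> c2 * w l powr s"
proof -
  have "w l powr s * w l powr (- s) = 1" using w_ge_1[of l] by (simp flip: powr_add)
  moreover have "w l powr s * w l powr (- s) \<le> w l powr s * (c2 * a l)"
    by (intro mult_left_mono weight_lower) simp
  ultimately show ?thesis using weight_pos[of l] by (simp add: divide_le_eq mult_ac)
qed

lemma summable_sobolev_norm:
  assumes "f \<in> sobolev_space d Y s"
  shows "summable (\<lambda>l. \<Sum>k\<in>K l. 1 / a l * (fourier_coeff Y f l k)\<^sup>2)"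
proof (rule summable_comparison_test')
  show "summable (\<lambda>l. c2 * (\<Sum>k\<in>K l. w l powr s * (fourier_coeff Y f l k)\<^sup>2))"
    using assms by (intro summable_mult) (simp add: sobolev_space_def)
  fix l
  have "norm (\<Sum>k\<in>K l. 1 / a l * (fourier_coeff Y f l k)\<^sup>2) = (\<Sum>k\<in>K l. 1 / a l * (fourier_coeff Y f l k)\<^sup>2)"
    using weight_pos[of l] by (simp add: sum_nonneg)
  also have "\<dots> \<le> (\<Sum>k\<in>K l. c2 * w l powr s * (fourier_coeff Y f l k)\<^sup>2)"
    by (intro sum_mono mult_right_mono weight_inverse_le) auto
  also have "\<dots> = c2 * (\<Sum>k\<in>K l. w l powr s * (fourier_coeff Y f l k)\<^sup>2)"
    by (simp add: sum_distrib_left mult.assoc)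
  finally show "norm (\<Sum>k\<in>K l. 1 / a l * (fourier_coeff Y f l k)\<^sup>2)
      \<le> c2 * (\<Sum>k\<in>K l. w l powr s * (fourier_coeff Y f l k)\<^sup>2)" .
qed

lemma sobolev_space_cmult:
  assumes f: "f \<in> sobolev_space d Y s" and cont: "continuous_on (sphere 0 1) f"
  shows "(\<lambda>x. c * f x) \<in> sobolev_space d Y s"
    and "sobolev_norm d Y a (\<lambda>x. c * f x) = \<bar>c\<bar> * sobolev_norm d Y a f"
proof -
  have "summable (\<lambda>l. c\<^sup>2 * (\<Sum>k\<in>K l. w l powr s * (fourier_coeff Y f l k)\<^sup>2))"
    using f by (intro summable_mult) (simp add: sobolev_space_def)
  then show "(\<lambda>x. c * f x) \<in> sobolev_space d Y s"
    using cont by (auto simp: sobolev_space_def fourier_coeff_cmult power_mult_distrib sum_distrib_left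
        mult_ac intro!: continuous_in_sphere_L2 continuous_intros)
  have "(\<Sum>l. \<Sum>k\<in>K l. 1 / a l * (c * fourier_coeff Y f l k)\<^sup>2)
      = (\<Sum>l. c\<^sup>2 * (\<Sum>k\<in>K l. 1 / a l * (fourier_coeff Y f l k)\<^sup>2))"
    by (simp add: power_mult_distrib sum_distrib_left mult_ac)
  also have "\<dots> = c\<^sup>2 * (\<Sum>l. \<Sum>k\<in>K l. 1 / a l * (fourier_coeff Y f l k)\<^sup>2)"
    by (rule suminf_mult[OF summable_sobolev_norm[OF f]])
  finally show "sobolev_norm d Y a (\<lambda>x. c * f x) = \<bar>c\<bar> * sobolev_norm d Y a f"
    by (simp add: sobolev_norm_def fourier_coeff_cmult real_sqrt_mult)
qed

lemma sobolev_norm_nonneg: "f \<in> sobolev_space d Y s \<Longrightarrow> 0 \<le> sobolev_norm d Y a f"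
  unfolding sobolev_norm_def using weight_pos
  by (intro real_sqrt_ge_zero suminf_nonneg summable_sobolev_norm sum_nonneg) (auto simp: less_imp_le)

lemma error_le_unit:
  assumes "f \<in> sobolev_space d Y s" "continuous_on (sphere 0 1) f" "sobolev_norm d Y a f \<le> 1"
  shows "\<bar>err f\<bar> \<le> \<epsilon>"
proof -
  have "ereal \<bar>err f\<bar> \<le> worst_case_error d Y a s P"
    unfolding worst_case_error_def quadrature_error_def
    by (rule SUP_upper) (use assms in simp)
  then have "ereal \<bar>err f\<bar> \<le> ereal \<epsilon>" using worst_case by (rule order.trans)
  then show ?thesis by simp
qed

text \<open>
  Homogeneity. When the norm vanishes, every multiple of \<open>f\<close> lies in the unit ball, so the error
  itself must vanish.
\<close>

lemma error_le_norm:
  assumes f: "f \<in> sobolev_space d Y s" and cont: "continuous_on (sphere 0 1) f"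
  shows "\<bar>err f\<bar> \<le> \<epsilon> * sobolev_norm d Y a f"
proof (cases "sobolev_norm d Y a f = 0")
  case True
  have "t * \<bar>err f\<bar> \<le> \<epsilon>" if "t \<ge> 0" for t
  proof -
    have "\<bar>err (\<lambda>x. t * f x)\<bar> \<le> \<epsilon>"
      by (rule error_le_unit) (use sobolev_space_cmult[OF f cont] True cont in \<open>auto intro!: continuous_intros\<close>)
    then show ?thesis using that by (simp add: quadrature_error_cmult abs_mult)
  qed
  note * = this
  have "\<bar>err f\<bar> = 0"
  proof (rule ccontr)
    assume "\<bar>err f\<bar> \<noteq> 0"
    then have "(\<bar>\<epsilon>\<bar> + 1) / \<bar>err f\<bar> * \<bar>err f\<bar> = \<bar>\<epsilon>\<bar> + 1" by simp
    then show False using *[of "(\<bar>\<epsilon>\<bar> + 1) / \<bar>err f\<bar>"] by simp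
  qed
  then show ?thesis using True by simp
next
  case False
  define n where "n = sobolev_norm d Y a f"
  have n: "n > 0" using sobolev_norm_nonneg[OF f] False by (simp add: n_def)
  have "\<bar>err (\<lambda>x. (1 / n) * f x)\<bar> \<le> \<epsilon>"
  proof (rule error_le_unit)
    show "sobolev_norm d Y a (\<lambda>x. (1 / n) * f x) \<le> 1"
      unfolding sobolev_space_cmult(2)[OF f cont] using n by (simp add: n_def[symmetric])
  qed (intro sobolev_space_cmult[OF f cont] continuous_intros cont)+
  then show ?thesis
    unfolding quadrature_error_cmult using n by (simp add: abs_mult n_def[symmetric] field_simps)
qed

lemma expansion_in_sobolev: "expansion M c \<in> sobolev_space d Y s"
proof -
  have "summable (\<lambda>l. \<Sum>k\<in>K l. w l powr s * (fourier_coeff Y (expansion M c) l k)\<^sup>2)"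
    by (rule summable_finite[of "{..<M}"]) (auto simp: fourier_coeff_expansion)
  then show ?thesis
    by (simp add: sobolev_space_def continuous_in_sphere_L2 continuous_expansion)
qed

text \<open>
  The remainder of \<open>f\<close> after removal of the degrees below \<open>M\<close> has a Sobolev norm tending to zero, hence so
  does its error. No convergence of the expansion to \<open>f\<close> is involved.
\<close>

lemma error_sums:
  assumes f: "f \<in> sobolev_space d Y s" and cont: "continuous_on (sphere 0 1) f"
  shows "(\<lambda>l. \<Sum>k\<in>K l. fourier_coeff Y f l k * err (Y l k)) sums err f"
proof -
  let ?c = "fourier_coeff Y f"
  define S where "S l = (\<Sum>k\<in>K l. 1 / a l * (?c l k)\<^sup>2)" for l
  have S: "summable S" unfolding S_def by (rule summable_sobolev_norm[OF f])
  define g where "g M x = f x - expansion M ?c x" for M x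
  have cg: "continuous_on (sphere 0 1) (g M)" for M
    unfolding g_def by (intro continuous_intros cont continuous_expansion)
  have fg: "fourier_coeff Y (g M) l k = (if l < M then 0 else ?c l k)" if "k \<in> K l" for M l k
    using that unfolding g_def
    by (simp add: fourier_coeff_diff[OF cont continuous_expansion that] fourier_coeff_expansion[OF that])
  have gs: "g M \<in> sobolev_space d Y s" for M
  proof -
    have "summable (\<lambda>l. \<Sum>k\<in>K l. w l powr s * (fourier_coeff Y (g M) l k)\<^sup>2)"
    proof (rule summable_comparison_test')
      show "summable (\<lambda>l. \<Sum>k\<in>K l. w l powr s * (?c l k)\<^sup>2)"
        using f by (simp add: sobolev_space_def)
      show "norm (\<Sum>k\<in>K l. w l powr s * (fourier_coeff Y (g M) l k)\<^sup>2) \<le> (\<Sum>k\<in>K l. w l powr s * (?c l k)\<^sup>2)" for l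
      proof -
        have "(\<Sum>k\<in>K l. w l powr s * (fourier_coeff Y (g M) l k)\<^sup>2) \<le> (\<Sum>k\<in>K l. w l powr s * (?c l k)\<^sup>2)"
          by (intro sum_mono mult_left_mono) (simp_all only: fg, auto)
        then show ?thesis by (simp add: sum_nonneg)
      qed
    qed
    then show ?thesis
      by (simp add: sobolev_space_def continuous_in_sphere_L2 cg)
  qed
  have err_g: "err (g M) = err f - (\<Sum>l<M. \<Sum>k\<in>K l. ?c l k * err (Y l k))" for M
    unfolding g_def quadrature_error_diff[OF cont continuous_expansion] quadrature_error_expansion ..
  have norm_g: "sobolev_norm d Y a (g M) = sqrt (suminf S - (\<Sum>l<M. S l))" for M
  proof -
    have "(\<Sum>k\<in>K l. 1 / a l * (fourier_coeff Y (g M) l k)\<^sup>2) = (if l < M then 0 else S l)" for l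
    proof -
      have "(\<Sum>k\<in>K l. 1 / a l * (fourier_coeff Y (g M) l k)\<^sup>2) = (\<Sum>k\<in>K l. 1 / a l * (if l < M then 0 else ?c l k)\<^sup>2)"
        by (intro sum.cong refl) (simp only: fg)
      then show ?thesis by (simp add: S_def)
    qed
    then have "(\<Sum>l. \<Sum>k\<in>K l. 1 / a l * (fourier_coeff Y (g M) l k)\<^sup>2) = (\<Sum>l. if l < M then 0 else S l)"
      by (rule suminf_cong)
    also have "\<dots> = (\<Sum>l. S l - (if l \<in> {..<M} then S l else 0))"
      by (intro suminf_cong) auto
    also have "\<dots> = suminf S - (\<Sum>l. if l \<in> {..<M} then S l else 0)"
      by (intro suminf_diff[symmetric] S summable_If_finite_set) auto
    also have "(\<Sum>l. if l \<in> {..<M} then S l else 0) = (\<Sum>l<M. S l)"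
      by (rule sums_unique[symmetric], rule sums_If_finite_set) simp
    finally show ?thesis by (simp add: sobolev_norm_def)
  qed
  have "(\<lambda>M. \<epsilon> * sqrt (suminf S - (\<Sum>l<M. S l))) \<longlonglongrightarrow> \<epsilon> * sqrt (suminf S - suminf S)"
    by (intro tendsto_intros summable_LIMSEQ S)
  then have "(\<lambda>M. \<epsilon> * sobolev_norm d Y a (g M)) \<longlonglongrightarrow> 0" by (simp add: norm_g)
  then have "(\<lambda>M. err (g M)) \<longlonglongrightarrow> 0"
    by (rule Lim_null_comparison[rotated]) (use error_le_norm[OF gs cg] in auto)
  then have "(\<lambda>M. err f - err (g M)) \<longlonglongrightarrow> err f - 0" by (intro tendsto_intros)
  then show ?thesis by (simp add: sums_def err_g)
qed

text \<open>
  The left half of the duality: the test function with coefficients \<open>a l * err (Y l k)\<close> has error \<open>T\<close> and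
  norm \<open>sqrt T\<close>, where \<open>T = \<Sum>l<M. a l * defect l\<close>.
\<close>

lemma defect_energy: "(\<Sum>l<M. w l powr (- s) * defect l) \<le> c2 * \<epsilon>\<^sup>2"
proof -
  define c where "c l k = a l * err (Y l k)" for l k
  define T where "T = (\<Sum>l<M. a l * defect l)"
  have T0: "0 \<le> T" using weight_pos by (auto simp: T_def less_imp_le intro!: sum_nonneg mult_nonneg_nonneg defect_nonneg)
  have "err (expansion M c) = T"
    by (simp add: quadrature_error_expansion c_def T_def defect_def sum_distrib_left power2_eq_square mult.assoc)
  moreover have "sobolev_norm d Y a (expansion M c) = sqrt T"
  proof -
    have "(\<Sum>k\<in>K l. 1 / a l * (fourier_coeff Y (expansion M c) l k)\<^sup>2) = (if l \<in> {..<M} then a l * defect l else 0)" for l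
    proof -
      have "(\<Sum>k\<in>K l. 1 / a l * (fourier_coeff Y (expansion M c) l k)\<^sup>2)
          = (\<Sum>k\<in>K l. if l < M then a l * (err (Y l k))\<^sup>2 else 0)"
        using weight_pos[of l]
        by (intro sum.cong refl) (simp add: fourier_coeff_expansion[unfolded atLeastAtMost_iff] c_def power2_eq_square)
      then show ?thesis by (simp add: defect_def sum_distrib_left)
    qed
    moreover have "(\<lambda>l. if l \<in> {..<M} then a l * defect l else 0) sums T"
      unfolding T_def by (rule sums_If_finite_set) simp
    ultimately show ?thesis
      by (simp add: sobolev_norm_def sums_iff)
  qed
  ultimately have "T \<le> \<epsilon> * sqrt T"
    using error_le_norm[OF expansion_in_sobolev continuous_expansion, of M c] T0 by simp
  then have "sqrt T * sqrt T \<le> \<epsilon> * sqrt T" using T0 by simp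
  then have "sqrt T \<le> \<bar>\<epsilon>\<bar>"
  proof (cases "T = 0")
    case False
    then have "0 < sqrt T" using T0 by simp
    with \<open>sqrt T * sqrt T \<le> \<epsilon> * sqrt T\<close> have "sqrt T \<le> \<epsilon>"
      by (rule mult_right_le_imp_le)
    then show ?thesis by simp
  qed simp
  then have "(sqrt T)\<^sup>2 \<le> \<bar>\<epsilon>\<bar>\<^sup>2" using T0 by (intro power_mono) auto
  then have "T \<le> \<epsilon>\<^sup>2" using T0 by simp
  have "(\<Sum>l<M. w l powr (- s) * defect l) \<le> (\<Sum>l<M. c2 * a l * defect l)"
    by (intro sum_mono mult_right_mono weight_lower defect_nonneg)
  also have "\<dots> = c2 * T" by (simp add: T_def sum_distrib_left mult.assoc)
  also have "\<dots> \<le> c2 * \<epsilon>\<^sup>2" using c2 \<open>T \<le> \<epsilon>\<^sup>2\<close> by simp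
  finally show ?thesis .
qed

end

section \<open>Growth of the defects\<close>

context quadrature begin

text \<open>
  Geometric decay of the Fourier coefficients makes a function as smooth as desired.
\<close>

lemma sobolev_space_damped:
  assumes cont: "continuous_on (sphere 0 1) f" and r: "0 < r" "r < 1"
    and b: "\<And>l. 0 \<le> b l" "summable b"
    and coeff: "\<And>l. (\<Sum>k\<in>K l. (fourier_coeff Y f l k)\<^sup>2) \<le> r ^ l * b l"
  shows "f \<in> sobolev_space d Y s"
proof -
  obtain C where C: "C > 0" "\<And>r l. 0 < r \<Longrightarrow> r < 1 \<Longrightarrow> w l powr s * r ^ l \<le> C * (1 - r) powr (- 2 * s)"
    using eigenval_powr_geometric_bounded[OF d s] by metis
  define B where "B = C * (1 - r) powr (- 2 * s)"
  have "summable (\<lambda>l. \<Sum>k\<in>K l. w l powr s * (fourier_coeff Y f l k)\<^sup>2)"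
  proof (rule summable_comparison_test')
    show "summable (\<lambda>l. B * b l)" by (intro summable_mult b)
    fix l
    have "(\<Sum>k\<in>K l. w l powr s * (fourier_coeff Y f l k)\<^sup>2) = w l powr s * (\<Sum>k\<in>K l. (fourier_coeff Y f l k)\<^sup>2)"
      by (simp only: sum_distrib_left)
    also have "\<dots> \<le> w l powr s * (r ^ l * b l)" by (intro mult_left_mono coeff) simp
    also have "\<dots> \<le> B * b l"
      using mult_right_mono[OF C(2)[OF r, of l] b(1)[of l]] by (simp add: B_def mult.assoc)
    finally show "norm (\<Sum>k\<in>K l. w l powr s * (fourier_coeff Y f l k)\<^sup>2) \<le> B * b l"
      by (simp add: sum_nonneg)
  qed
  then show ?thesis
    by (simp add: sobolev_space_def continuous_in_sphere_L2 cont)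
qed

lemma summable_defect: "summable (\<lambda>l. w l powr (- s) * defect l)"
  by (rule summableI_nonneg_bounded[OF _ defect_energy]) (simp add: defect_nonneg)

definition poisson_energy :: "real \<Rightarrow> real" where
  "poisson_energy r = 1 / real (size P) * (\<Sum>y\<in>#P. 1 / real (size P) * (\<Sum>x\<in>#P. poisson (r *\<^sub>R x) y))"

text \<open>
  The kernel averaged over the nodes, minus \<open>1\<close>, has the Fourier coefficients \<open>r ^ l * err (Y l k)\<close>.
  Expanding its quadrature error in harmonics gives the series; evaluating the error directly gives
  the double average.
\<close>

lemma defect_generating_function:
  assumes r: "0 < r" "r < 1"
  shows "(\<lambda>l. r ^ l * defect l) sums (poisson_energy r - 1)"
proof -
  let ?N = "real (size P)"
  have N: "?N > 0" using nonempty by (simp add: nonempty_has_size)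
  have inS: "x \<in> sphere 0 1" if "x \<in># P" for x using that on_sphere by auto
  have inB: "r *\<^sub>R x \<in> ball 0 1" if "x \<in># P" for x using inS[OF that] r by simp
  have cp: "continuous_on (sphere 0 1) (\<lambda>y. poisson (r *\<^sub>R x) y * f y)"
    if "x \<in># P" "continuous_on (sphere 0 1) f" for x f
    by (rule continuous_on_poisson_mult[OF that(2) inB[OF that(1)]])
  define F where "F y = 1 / ?N * (\<Sum>x\<in>#P. poisson (r *\<^sub>R x) y)" for y
  have cF: "continuous_on (sphere 0 1) F"
    unfolding F_def using cp[of _ "\<lambda>_. 1"]
    by (intro continuous_intros continuous_on_sum_mset) auto
  have int_F: "(LINT y|sphere_measure. F y * f y) = 1 / ?N * (\<Sum>x\<in>#P. poisson_integral f (r *\<^sub>R x))"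
    if "continuous_on (sphere 0 1) f" for f
  proof -
    have "(LINT y|sphere_measure. F y * f y) = (LINT y|sphere_measure. 1 / ?N * (\<Sum>x\<in>#P. poisson (r *\<^sub>R x) y * f y))"
      by (simp add: F_def sum_mset_distrib_right)
    also have "\<dots> = 1 / ?N * (LINT y|sphere_measure. (\<Sum>x\<in>#P. poisson (r *\<^sub>R x) y * f y))"
      by (rule integral_mult_right_zero)
    also have "(LINT y|sphere_measure. (\<Sum>x\<in>#P. poisson (r *\<^sub>R x) y * f y)) = (\<Sum>x\<in>#P. poisson_integral f (r *\<^sub>R x))"
      unfolding poisson_integral_def
      by (intro integral_sum_mset(2) integrable_sphere_continuous cp that)
    finally show ?thesis .
  qed
  define g where "g y = F y - 1" for y
  have cg: "continuous_on (sphere 0 1) g" unfolding g_def by (intro continuous_intros cF)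
  have coeff: "fourier_coeff Y g l k = r ^ l * err (Y l k)" if k: "k \<in> K l" for l k
  proof -
    have "fourier_coeff Y g l k = (LINT y|sphere_measure. F y * Y l k y) - (LINT y|sphere_measure. Y l k y)"
      unfolding fourier_coeff_def g_def left_diff_distrib mult_1
      by (intro Bochner_Integration.integral_diff integrable_sphere_continuous continuous_intros cF k)
    also have "(LINT y|sphere_measure. F y * Y l k y) = 1 / ?N * (\<Sum>x\<in>#P. r ^ l * Y l k x)"
    proof -
      have "(\<Sum>x\<in>#P. poisson_integral (Y l k) (r *\<^sub>R x)) = (\<Sum>x\<in>#P. r ^ l * Y l k x)"
        by (intro arg_cong[where f = sum_mset] image_mset_cong poisson_integral_spherical_harmonic harmonic[OF k] r inS)
      then show ?thesis by (simp only: int_F[OF continuous_harmonic[OF k]])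
    qed
    also have "\<dots> - (LINT y|sphere_measure. Y l k y)
        = r ^ l * err (Y l k) + (r ^ l - 1) * (LINT y|sphere_measure. Y l k y)"
      by (simp add: quadrature_error_def sum_mset_distrib_left[symmetric] algebra_simps)
    \<comment> \<open>Subtracting \<open>1\<close> from the averaged kernel matters for degree \<open>0\<close> only.\<close>
    also have "(r ^ l - 1) * (LINT y|sphere_measure. Y l k y) = 0"
      using integral_harmonic[OF k] by (cases "l = 0") auto
    finally show ?thesis by simp
  qed
  have "g \<in> sobolev_space d Y s"
  proof -
    obtain C where C: "C > 0" "\<And>r l. 0 < r \<Longrightarrow> r < 1 \<Longrightarrow> w l powr s * r ^ l \<le> C * (1 - r) powr (- 2 * s)"
      using eigenval_powr_geometric_bounded[OF d s] by metis
    define B where "B = C * (1 - r) powr (- 2 * s)"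
    have B: "r ^ l \<le> B * w l powr (- s)" for l
    proof -
      have "w l powr s * w l powr (- s) = 1" using w_ge_1[of l] by (simp flip: powr_add)
      then have "r ^ l = w l powr s * r ^ l * w l powr (- s)" by (simp add: mult_ac)
      also have "\<dots> \<le> B * w l powr (- s)"
        using C(2)[OF r] by (intro mult_right_mono) (auto simp: B_def)
      finally show ?thesis .
    qed
    show ?thesis
    proof (rule sobolev_space_damped[OF cg r])
      show "summable (\<lambda>l. B * (w l powr (- s) * defect l))"
        by (intro summable_mult summable_defect)
      show "0 \<le> B * (w l powr (- s) * defect l)" for l
        using C(1) by (auto simp: B_def defect_nonneg)
      fix l
      have "(\<Sum>k\<in>K l. (fourier_coeff Y g l k)\<^sup>2) = (\<Sum>k\<in>K l. r ^ l * (r ^ l * (err (Y l k))\<^sup>2))"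
        by (intro sum.cong refl) (simp only: coeff power2_eq_square mult_ac)
      also have "\<dots> = r ^ l * (r ^ l * defect l)" by (simp add: defect_def sum_distrib_left)
      also have "\<dots> \<le> r ^ l * (B * w l powr (- s) * defect l)"
        using r by (intro mult_left_mono mult_right_mono B defect_nonneg) auto
      finally show "(\<Sum>k\<in>K l. (fourier_coeff Y g l k)\<^sup>2) \<le> r ^ l * (B * (w l powr (- s) * defect l))"
        by (simp only: mult.assoc)
    qed
  qed
  from error_sums[OF this cg] have "(\<lambda>l. \<Sum>k\<in>K l. fourier_coeff Y g l k * err (Y l k)) sums err g" .
  moreover have "(\<Sum>k\<in>K l. fourier_coeff Y g l k * err (Y l k)) = r ^ l * defect l" for l
  proof -
    have "(\<Sum>k\<in>K l. fourier_coeff Y g l k * err (Y l k)) = (\<Sum>k\<in>K l. r ^ l * (err (Y l k))\<^sup>2)"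
      by (intro sum.cong refl) (simp only: coeff power2_eq_square mult.assoc)
    then show ?thesis by (simp add: defect_def sum_distrib_left)
  qed
  moreover have "err g = poisson_energy r - 1"
  proof -
    have "(\<Sum>x\<in>#P. poisson_integral (\<lambda>_. 1) (r *\<^sub>R x)) = (\<Sum>x\<in>#P. 1)"
      by (intro arg_cong[where f = sum_mset] image_mset_cong)
        (use integral_poisson[OF inB] in \<open>simp add: poisson_integral_def\<close>)
    then have "(LINT y|sphere_measure. F y) = 1"
      using int_F[of "\<lambda>_. 1"] nonempty by simp
    moreover have "poisson_energy r = 1 / ?N * (\<Sum>y\<in>#P. F y)"
      by (simp only: poisson_energy_def F_def)
    ultimately have "err F = poisson_energy r - 1"
      by (simp only: quadrature_error_def)
    moreover have "err (\<lambda>_. 1) = 0" using nonempty by (simp add: quadrature_error_def)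
    ultimately show ?thesis
      unfolding g_def by (simp add: quadrature_error_diff[OF cF continuous_on_const])
  qed
  ultimately show ?thesis by simp
qed

text \<open>
  Averages over pairs of nodes with positive weights preserve pointwise inequalities between
  kernels.
\<close>

lemma poisson_energy_comparison:
  assumes r: "0 < r" "r \<le> r'" "r' < 1"
  shows "poisson_energy r' \<le> 2 * ((1 - r) / (1 - r')) ^ (DIM('a) - 1) * poisson_energy r"
proof -
  let ?q = "2 * ((1 - r) / (1 - r')) ^ (DIM('a) - 1)"
  have "poisson_energy r' \<le> 1 / real (size P) * (\<Sum>y\<in>#P. 1 / real (size P) * (\<Sum>x\<in>#P. ?q * poisson (r *\<^sub>R x) y))"
    unfolding poisson_energy_def using on_sphere
    by (intro mult_left_mono sum_mset_mono poisson_comparison r) auto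
  also have "\<dots> = ?q * poisson_energy r"
    by (simp only: poisson_energy_def sum_mset_distrib_left[symmetric] mult.left_commute[of _ ?q])
  finally show ?thesis .
qed

text \<open>
  At the reference parameter \<open>r\<close> the energy is bounded by the low-order estimate
  \<open>defect_energy\<close>; the kernel comparison transfers this bound to \<open>r'\<close> at the cost of
  the power of \<open>(1 - r) / (1 - r')\<close>.
\<close>

lemma damped_defect_bound:
  assumes C: "\<And>r l. 0 < r \<Longrightarrow> r < 1 \<Longrightarrow> w l powr s * r ^ l \<le> C * (1 - r) powr (- 2 * s)"
    and r: "0 < r" "r \<le> r'" "r' < 1"
  shows "(\<Sum>l<M. r' ^ l * defect l)
      \<le> 2 * ((1 - r) / (1 - r')) ^ (DIM('a) - 1) * (1 + C * (1 - r) powr (- 2 * s) * (c2 * \<epsilon>\<^sup>2))"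
proof -
  let ?B = "C * (1 - r) powr (- 2 * s)"
  have r1: "r < 1" "0 < r'" using r by auto
  have C0: "0 \<le> ?B"
  proof -
    have "0 \<le> w 0 powr s * r ^ 0" by simp
    then show ?thesis using C[OF r(1) r1(1), of 0] by linarith
  qed
  have "(\<Sum>l<M. r' ^ l * defect l) \<le> poisson_energy r' - 1"
    using defect_generating_function[OF r1(2) r(3)] r1
    by (simp add: sums_iff) (metis (no_types, lifting) defect_nonneg less_imp_le mult_nonneg_nonneg sum_le_suminf finite_lessThan zero_le_power)
  also have "\<dots> \<le> poisson_energy r'" by simp
  also have "\<dots> \<le> 2 * ((1 - r) / (1 - r')) ^ (DIM('a) - 1) * poisson_energy r"
    by (rule poisson_energy_comparison[OF r])
  also have "\<dots> \<le> 2 * ((1 - r) / (1 - r')) ^ (DIM('a) - 1) * (1 + ?B * (c2 * \<epsilon>\<^sup>2))"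
  proof (rule mult_left_mono)
    have "(\<Sum>l<M. r ^ l * defect l) \<le> ?B * (c2 * \<epsilon>\<^sup>2)" for M
    proof -
      have "(\<Sum>l<M. r ^ l * defect l) \<le> (\<Sum>l<M. ?B * (w l powr (- s) * defect l))"
      proof (rule sum_mono)
        fix l
        have "w l powr s * w l powr (- s) = 1" using w_ge_1[of l] by (simp flip: powr_add)
        then have "r ^ l = w l powr s * r ^ l * w l powr (- s)" by (simp add: mult_ac)
        also have "\<dots> \<le> ?B * w l powr (- s)"
          by (intro mult_right_mono C r r1) simp
        finally have "r ^ l * defect l \<le> ?B * w l powr (- s) * defect l"
          by (intro mult_right_mono defect_nonneg)
        then show "r ^ l * defect l \<le> ?B * (w l powr (- s) * defect l)" by (simp only: mult.assoc)
      qed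
      also have "\<dots> = ?B * (\<Sum>l<M. w l powr (- s) * defect l)" by (simp only: sum_distrib_left)
      also have "\<dots> \<le> ?B * (c2 * \<epsilon>\<^sup>2)" by (intro mult_left_mono defect_energy C0)
      finally show ?thesis .
    qed
    then have "poisson_energy r - 1 \<le> ?B * (c2 * \<epsilon>\<^sup>2)"
      using defect_generating_function[OF r(1) r1(1)] unfolding sums_def
      by (intro LIMSEQ_le_const2) auto
    then show "poisson_energy r \<le> 1 + ?B * (c2 * \<epsilon>\<^sup>2)" by simp
    show "0 \<le> 2 * ((1 - r) / (1 - r')) ^ (DIM('a) - 1)" using r by simp
  qed
  finally show ?thesis .
qed

text \<open>
  The error of the Poisson integral of \<open>f\<close> is expanded in harmonics and estimated by the weighted
  arithmetic-geometric mean inequality with parameter \<open>\<theta>\<close>; then \<open>r\<close> tends to \<open>1\<close>.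
\<close>

lemma error_le_of_defect_bound:
  fixes a' :: "nat \<Rightarrow> real"
  assumes f: "f \<in> sobolev_space d Y s'" and cont: "continuous_on (sphere 0 1) f"
    and s': "0 \<le> s'" and a': "\<And>l. a' l > 0"
    and c': "\<And>l. 1 / a' l \<le> c' * w l powr s'"
    and norm: "sobolev_norm d Y a' f \<le> 1"
    and T: "\<And>M. (\<Sum>l<M. a' l * defect l) \<le> T" and \<theta>: "\<theta> > 0"
  shows "\<bar>err f\<bar> \<le> \<theta> / 2 + T / (2 * \<theta>)"
proof -
  let ?c = "fourier_coeff Y f"
  let ?N = "real (size P)"
  have N: "?N > 0" using nonempty by (simp add: nonempty_has_size)
  have inS: "x \<in> sphere 0 1" if "x \<in># P" for x using that on_sphere by auto
  define b where "b l = (\<Sum>k\<in>K l. w l powr s' * (?c l k)\<^sup>2)" for l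
  have b: "summable b" "0 \<le> b l" for l
    using f by (auto simp: sobolev_space_def b_def[abs_def] sum_nonneg)
  define S where "S l = (\<Sum>k\<in>K l. 1 / a' l * (?c l k)\<^sup>2)" for l
  have S0: "0 \<le> S l" for l using a'[of l] by (simp add: S_def sum_nonneg)
  have S: "summable S"
  proof (rule summable_comparison_test')
    show "summable (\<lambda>l. c' * b l)" by (intro summable_mult b)
    fix l
    have "S l \<le> (\<Sum>k\<in>K l. c' * w l powr s' * (?c l k)\<^sup>2)"
      unfolding S_def by (intro sum_mono mult_right_mono c') simp
    then show "norm (S l) \<le> c' * b l" using S0[of l] by (simp add: b_def sum_distrib_left mult.assoc)
  qed
  have S1: "(\<Sum>l<M. S l) \<le> 1" for M
  proof -
    have "(\<Sum>l<M. S l) \<le> suminf S" by (rule sum_le_suminf[OF S]) (auto simp: S0)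
    also have "\<dots> \<le> 1" using norm by (simp add: sobolev_norm_def S_def[abs_def])
    finally show ?thesis .
  qed
  have smooth: "\<bar>err (\<lambda>x. poisson_integral f (r *\<^sub>R x))\<bar> \<le> \<theta> / 2 + T / (2 * \<theta>)"
    if r: "0 < r" "r < 1" for r
  proof -
    define g where "g x = poisson_integral f (r *\<^sub>R x)" for x
    have cg: "continuous_on (sphere 0 1) g"
    proof -
      have "continuous_on (cball 0 r) (poisson_integral f)"
        by (rule continuous_on_poisson_integral[OF cont]) (use r in auto)
      then show ?thesis unfolding g_def
        by (rule continuous_on_compose2) (use r in \<open>auto intro!: continuous_intros\<close>)
    qed
    have coeff: "fourier_coeff Y g l k = r ^ l * ?c l k" if "k \<in> K l" for l k
      unfolding fourier_coeff_def g_def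
      by (rule integral_poisson_integral_mult[OF cont harmonic[OF that] r])
    have r1: "0 \<le> r ^ l" "r ^ l \<le> 1" for l using r by (auto simp: power_le_one)
    have "g \<in> sobolev_space d Y s"
    proof (rule sobolev_space_damped[OF cg r])
      show "summable b" "0 \<le> b l" for l by (rule b)+
      fix l
      have "(\<Sum>k\<in>K l. (fourier_coeff Y g l k)\<^sup>2) = (\<Sum>k\<in>K l. r ^ l * (r ^ l * (?c l k)\<^sup>2))"
        by (intro sum.cong refl) (simp only: coeff power2_eq_square mult_ac)
      also have "\<dots> \<le> (\<Sum>k\<in>K l. r ^ l * (w l powr s' * (?c l k)\<^sup>2))"
      proof (intro sum_mono mult_left_mono mult_right_mono r1)
        have "1 \<le> w l powr s'" using w_ge_1[of l] s' by (rule ge_one_powr_ge_zero)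
        then show "r ^ l \<le> w l powr s'" using r1(2)[of l] by linarith
      qed simp
      finally show "(\<Sum>k\<in>K l. (fourier_coeff Y g l k)\<^sup>2) \<le> r ^ l * b l"
        by (simp only: b_def sum_distrib_left)
    qed
    from error_sums[OF this cg]
    have sums: "(\<lambda>M. \<Sum>l<M. \<Sum>k\<in>K l. fourier_coeff Y g l k * err (Y l k)) \<longlonglongrightarrow> err g"
      by (simp add: sums_def)
    have partial: "\<bar>\<Sum>l<M. \<Sum>k\<in>K l. fourier_coeff Y g l k * err (Y l k)\<bar> \<le> \<theta> / 2 + T / (2 * \<theta>)" for M
    proof -
      have summand: "\<bar>fourier_coeff Y g l k * err (Y l k)\<bar>
          \<le> \<theta> / 2 * (1 / a' l * (?c l k)\<^sup>2) + 1 / (2 * \<theta>) * (a' l * (err (Y l k))\<^sup>2)" if k: "k \<in> K l" for l k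
      proof -
        have "\<bar>fourier_coeff Y g l k * err (Y l k)\<bar> = r ^ l * (\<bar>?c l k\<bar> * \<bar>err (Y l k)\<bar>)"
          using r1(1)[of l] by (simp add: coeff[OF k] abs_mult)
        also have "\<dots> \<le> 1 * (\<bar>?c l k\<bar> * \<bar>err (Y l k)\<bar>)"
          by (intro mult_right_mono r1) auto
        also have "\<dots> \<le> \<theta> / 2 * (1 / a' l * (?c l k)\<^sup>2) + 1 / (2 * \<theta>) * (a' l * (err (Y l k))\<^sup>2)"
        proof -
          have "0 \<le> (\<theta> * \<bar>?c l k\<bar> - a' l * \<bar>err (Y l k)\<bar>)\<^sup>2 / (2 * \<theta> * a' l)"
            using \<theta> a'[of l] by simp
          also have "\<dots> = \<theta> / 2 * (1 / a' l * \<bar>?c l k\<bar>\<^sup>2) + 1 / (2 * \<theta>) * (a' l * \<bar>err (Y l k)\<bar>\<^sup>2)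
              - \<bar>?c l k\<bar> * \<bar>err (Y l k)\<bar>"
            using \<theta> a'[of l] unfolding power2_eq_square by (simp add: field_simps)
          finally show ?thesis by simp
        qed
        finally show ?thesis .
      qed
      have "\<bar>\<Sum>l<M. \<Sum>k\<in>K l. fourier_coeff Y g l k * err (Y l k)\<bar>
          \<le> (\<Sum>l<M. \<Sum>k\<in>K l. \<bar>fourier_coeff Y g l k * err (Y l k)\<bar>)"
        by (rule order.trans[OF sum_abs sum_mono[OF sum_abs]])
      also have "\<dots> \<le> (\<Sum>l<M. \<Sum>k\<in>K l. \<theta> / 2 * (1 / a' l * (?c l k)\<^sup>2) + 1 / (2 * \<theta>) * (a' l * (err (Y l k))\<^sup>2))"
        by (intro sum_mono summand)
      also have "\<dots> = \<theta> / 2 * (\<Sum>l<M. S l) + 1 / (2 * \<theta>) * (\<Sum>l<M. a' l * defect l)"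
        by (simp only: S_def defect_def sum.distrib sum_distrib_left)
      also have "\<dots> \<le> \<theta> / 2 * 1 + 1 / (2 * \<theta>) * T"
        using \<theta> by (intro add_mono mult_left_mono S1 T) auto
      finally show ?thesis by simp
    qed
    have "(\<lambda>M. \<bar>\<Sum>l<M. \<Sum>k\<in>K l. fourier_coeff Y g l k * err (Y l k)\<bar>) \<longlonglongrightarrow> \<bar>err g\<bar>"
      by (intro tendsto_rabs sums)
    then have "\<bar>err g\<bar> \<le> \<theta> / 2 + T / (2 * \<theta>)"
      by (rule LIMSEQ_le_const2) (use partial in auto)
    then show ?thesis unfolding g_def .
  qed
  show ?thesis
  proof (rule field_le_epsilon)
    fix e :: real assume e: "e > 0"
    have "\<forall>\<^sub>F r in at_left 1. \<forall>x\<in>sphere 0 1. \<bar>poisson_integral f (r *\<^sub>R x) - f x\<bar> \<le> e"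
      by (rule poisson_approximate_identity[OF cont e])
    moreover have "\<forall>\<^sub>F r::real in at_left 1. r \<in> {0<..<1}"
      by (rule eventually_at_left_real) simp
    ultimately have "\<forall>\<^sub>F r in at_left 1. (\<forall>x\<in>sphere 0 1. \<bar>poisson_integral f (r *\<^sub>R x) - f x\<bar> \<le> e) \<and> r \<in> {0<..<1}"
      by (rule eventually_conj)
    then have "\<exists>r. (\<forall>x\<in>sphere 0 1. \<bar>poisson_integral f (r *\<^sub>R x) - f x\<bar> \<le> e) \<and> r \<in> {0<..<1}"
      by (rule eventually_happens'[OF trivial_limit_at_left_real])
    then obtain r where r: "0 < r" "r < 1" and close: "\<And>x. x \<in> sphere 0 1 \<Longrightarrow> \<bar>poisson_integral f (r *\<^sub>R x) - f x\<bar> \<le> e"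
      by auto
    have "(LINT x|sphere_measure. poisson_integral f (r *\<^sub>R x)) = (LINT x|sphere_measure. f x)"
      using integral_poisson_integral_mult[OF cont spherical_harmonic_const[of 1] r] by simp
    then have "err (\<lambda>x. poisson_integral f (r *\<^sub>R x)) - err f
        = 1 / ?N * ((\<Sum>x\<in>#P. poisson_integral f (r *\<^sub>R x)) - (\<Sum>x\<in>#P. f x))"
      by (simp add: quadrature_error_def right_diff_distrib)
    also have "(\<Sum>x\<in>#P. poisson_integral f (r *\<^sub>R x)) - (\<Sum>x\<in>#P. f x) = (\<Sum>x\<in>#P. poisson_integral f (r *\<^sub>R x) - f x)"
      by (induction P) auto
    finally have "\<bar>err (\<lambda>x. poisson_integral f (r *\<^sub>R x)) - err f\<bar>
        = 1 / ?N * \<bar>\<Sum>x\<in>#P. poisson_integral f (r *\<^sub>R x) - f x\<bar>"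
      using N by (simp add: abs_mult)
    also have "\<dots> \<le> 1 / ?N * (?N * e)"
      by (intro mult_left_mono abs_sum_mset_le close inS) auto
    also have "\<dots> = e" using nonempty by simp
    finally show "\<bar>err f\<bar> \<le> \<theta> / 2 + T / (2 * \<theta>) + e"
      using smooth[OF r] by linarith
  qed
qed

end

section \<open>Smaller smoothness\<close>

theorem theorem4:
  fixes d :: nat and s :: real
    and Y :: "nat \<Rightarrow> nat \<Rightarrow> 'a::euclidean_space \<Rightarrow> real"
    and a :: "real \<Rightarrow> nat \<Rightarrow> real"
    and I :: "nat set" and X :: "nat \<Rightarrow> 'a multiset"
  assumes "d \<ge> 2" and "DIM('a) = d + 1"
    and "orthonormal_harmonics d Y"
    and "\<And>t. t > real d / 2 \<Longrightarrow> admissible_weights d t (a t)"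
    and "s > real d / 2"
    and "qmc_designs d Y (a s) s I X"
  shows "\<forall>s'. real d / 2 < s' \<and> s' \<le> s \<longrightarrow> qmc_designs d Y (a s') s' I X"
proof (intro allI impI)
  fix s' assume s': "real d / 2 < s' \<and> s' \<le> s"
  have d: "d \<ge> 1" and d0: "real d > 0" using assms(1) by auto
  have s'0: "s' \<ge> 0" and s0: "s \<ge> 0" using s' d0 by (smt (verit) divide_pos_pos)+
  obtain c2 where c2: "c2 > 0" "\<And>l. a s l > 0" "\<And>l. (1 + eigenval d l) powr (- s) \<le> c2 * a s l"
    using assms(4)[OF assms(5)] unfolding admissible_weights_def by blast
  obtain c1' c2' where c': "c1' > 0" "c2' > 0" "\<And>l. a s' l > 0"
      "\<And>l. c1' * a s' l \<le> (1 + eigenval d l) powr (- s')"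
      "\<And>l. (1 + eigenval d l) powr (- s') \<le> c2' * a s' l"
    using assms(4)[of s'] s' unfolding admissible_weights_def by blast
  have inverse: "1 / a s' l \<le> c2' * (1 + eigenval d l) powr s'" for l
  proof -
    have "(1 + eigenval d l) powr s' * (1 + eigenval d l) powr (- s') = 1"
      using eigenval_bounds(3)[OF d, of l] by (simp flip: powr_add)
    moreover have "(1 + eigenval d l) powr s' * (1 + eigenval d l) powr (- s')
        \<le> (1 + eigenval d l) powr s' * (c2' * a s' l)"
      by (intro mult_left_mono c') simp
    ultimately show ?thesis using c'(3)[of l] by (simp add: divide_le_eq mult_ac)
  qed
  from assms(6) obtain c where conf: "configuration_sequence I X" and c: "c > 0"
      "\<And>N. N \<in> I \<Longrightarrow> worst_case_error d Y (a s) s (X N) \<le> ereal (c / real N powr (s / real d))"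
    unfolding qmc_designs_def by blast
  obtain C where C: "C > 0" "\<And>r l. 0 < r \<Longrightarrow> r < 1 \<Longrightarrow>
      (1 + eigenval d l) powr s * r ^ l \<le> C * (1 - r) powr (- 2 * s)"
    using eigenval_powr_geometric_bounded[OF d s0] by metis
  define A where "A = c2 * (c\<^sup>2 * 2 powr (2 * s))"
  define B where "B = 2 * (1 + C * A)"
  have A0: "0 \<le> A" and B0: "0 \<le> B" using c2(1) C(1) by (auto simp: A_def B_def)
  obtain G where G: "G > 0"
    and dyadic: "\<forall>h (D :: nat \<Rightarrow> real) M. 0 < h \<longrightarrow> h \<le> 1 / 2 \<longrightarrow> (\<forall>l. 0 \<le> D l) \<longrightarrow>
       (\<forall>M. (\<Sum>l<M. (1 + eigenval d l) powr (- s) * D l) \<le> A * h powr (2 * s)) \<longrightarrow>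
       (\<forall>j M. (\<Sum>l<M. (1 - h / 2 ^ j) ^ l * D l) \<le> B * 2 ^ (j * d)) \<longrightarrow>
       (\<Sum>l<M. (1 + eigenval d l) powr (- s') * D l) \<le> G * h powr (2 * s')"
    using dyadic_energy_bound[OF d conjunct1[OF s'] conjunct2[OF s'] A0 B0] by blast
  define c'' where "c'' = (1 + G / c1') / 2"
  have "c'' > 0" using G c'(1) by (simp add: c''_def add_pos_pos)
  moreover have "worst_case_error d Y (a s') s' (X N) \<le> ereal (c'' / real N powr (s' / real d))"
    if N: "N \<in> I" for N
  proof -
    have N1: "N \<ge> 1" and size: "size (X N) = N" and sub: "set_mset (X N) \<subseteq> sphere 0 1"
      using conf N unfolding configuration_sequence_def by (auto simp: Suc_le_eq intro: gr0I)
    \<comment> \<open>The critical scale; halving keeps \<open>1 - h\<close> positive for \<open>N = 1\<close>.\<close>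
    define h where "h = real N powr (- 1 / real d) / 2"
    have h: "0 < h" "h \<le> 1 / 2"
    proof -
      have "real N powr (- 1 / real d) \<le> real N powr 0"
        using N1 d0 by (intro powr_mono) auto
      then show "0 < h" "h \<le> 1 / 2" using N1 by (auto simp: h_def)
    qed
    have Nh: "1 / real N powr (t / real d) = (2 * h) powr t" for t
    proof -
      have "(2 * h) powr t = real N powr (- (t / real d))"
        unfolding h_def by (simp add: powr_powr)
      then show ?thesis by (simp add: powr_minus_divide)
    qed
    define \<epsilon> where "\<epsilon> = c * (2 * h) powr s"
    have \<epsilon>: "c2 * \<epsilon>\<^sup>2 = A * h powr (2 * s)"
    proof -
      have "((2 * h) powr s)\<^sup>2 = (2 * h) powr (2 * s)"
        using h by (simp add: power2_eq_square flip: powr_add)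
      also have "\<dots> = 2 powr (2 * s) * h powr (2 * s)" using h by (simp add: powr_mult)
      finally show ?thesis by (simp add: \<epsilon>_def A_def power_mult_distrib)
    qed
    interpret quadrature d Y s "a s" c2 "X N" \<epsilon>
    proof
      show "X N \<noteq> {#}" using size N1 by auto
      show "worst_case_error d Y (a s) s (X N) \<le> ereal \<epsilon>"
        using c(2)[OF N] Nh[of s] by (simp add: \<epsilon>_def divide_inverse)
    qed (use assms(3) d s0 c2 sub in auto)
    have defect: "(\<Sum>l<M. (1 + eigenval d l) powr (- s') * defect l) \<le> G * h powr (2 * s')" for M
    proof (rule dyadic[rule_format, OF h defect_nonneg])
      show "(\<Sum>l<M. (1 + eigenval d l) powr (- s) * defect l) \<le> A * h powr (2 * s)" for M
        using defect_energy[of M] unfolding \<epsilon> .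
      fix j M
      have hj: "0 < h / 2 ^ j" "h / 2 ^ j \<le> h"
        using h divide_left_mono[of 1 "2 ^ j" h] by auto
      have "(\<Sum>l<M. (1 - h / 2 ^ j) ^ l * defect l)
          \<le> 2 * ((1 - (1 - h)) / (1 - (1 - h / 2 ^ j))) ^ (DIM('a) - 1)
              * (1 + C * (1 - (1 - h)) powr (- 2 * s) * (c2 * \<epsilon>\<^sup>2))"
        by (rule damped_defect_bound[OF C(2)]) (use h hj in auto)
      also have "(1 - (1 - h)) / (1 - (1 - h / 2 ^ j)) = 2 ^ j"
        using h by simp
      also have "C * (1 - (1 - h)) powr (- 2 * s) * (c2 * \<epsilon>\<^sup>2) = C * A"
      proof -
        have "h powr (- 2 * s) * h powr (2 * s) = 1" using h by (simp flip: powr_add)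
        then show ?thesis unfolding \<epsilon> by (simp add: mult_ac)
      qed
      finally show "(\<Sum>l<M. (1 - h / 2 ^ j) ^ l * defect l) \<le> B * 2 ^ (j * d)"
        using assms(2) by (simp add: B_def algebra_simps flip: power_mult)
    qed
    define T where "T = G / c1' * h powr (2 * s')"
    have T: "(\<Sum>l<M. a s' l * defect l) \<le> T" for M
    proof -
      have "c1' * (\<Sum>l<M. a s' l * defect l) = (\<Sum>l<M. c1' * a s' l * defect l)"
        by (simp only: sum_distrib_left mult.assoc)
      also have "\<dots> \<le> (\<Sum>l<M. (1 + eigenval d l) powr (- s') * defect l)"
        by (intro sum_mono mult_right_mono c' defect_nonneg)
      also have "\<dots> \<le> G * h powr (2 * s')" by (rule defect)
      finally show ?thesis using c'(1) by (simp add: T_def field_simps)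
    qed
    \<comment> \<open>This choice balances the two summands, since \<open>T\<close> is of order \<open>\<theta>\<^sup>2\<close>.\<close>
    define \<theta> where "\<theta> = h powr s'"
    have \<theta>: "\<theta> > 0" using h by (simp add: \<theta>_def)
    have "h powr (2 * s') = \<theta> * \<theta>"
      by (simp add: \<theta>_def flip: powr_add)
    then have "\<theta> / 2 + T / (2 * \<theta>) = c'' * \<theta>"
      using \<theta> by (simp add: T_def c''_def field_simps)
    also have "\<theta> \<le> (2 * h) powr s'"
      unfolding \<theta>_def using h s'0 by (intro powr_mono2) auto
    then have "c'' * \<theta> \<le> c'' / real N powr (s' / real d)"
      using \<open>c'' > 0\<close> Nh[of s'] by (simp add: divide_inverse mult_left_mono)
    finally have bound: "\<theta> / 2 + T / (2 * \<theta>) \<le> c'' / real N powr (s' / real d)" .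
    show ?thesis
      unfolding worst_case_error_def quadrature_error_def[symmetric]
    proof (rule SUP_least)
      fix f assume "f \<in> {f \<in> sobolev_space d Y s'. continuous_on (sphere 0 1) f \<and> sobolev_norm d Y (a s') f \<le> 1}"
      then have "\<bar>quadrature_error (X N) f\<bar> \<le> \<theta> / 2 + T / (2 * \<theta>)"
        by (intro error_le_of_defect_bound[OF _ _ s'0 c'(3) inverse _ T \<theta>]) auto
      then show "ereal \<bar>quadrature_error (X N) f\<bar> \<le> ereal (c'' / real N powr (s' / real d))"
        using bound by simp
    qed
  qed
  ultimately show "qmc_designs d Y (a s') s' I X"
    using conf unfolding qmc_designs_def by blast
qed
end
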